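(* Let $S=\{0\}\cup B_1$ be a compact distance set with exactly one nontrivial block $B_1$. Then every finite $S$-metric space has finite big Ramsey degree in $\mathcal{U}_S$, the Fraïssé limit of the class of finite $S$-metric spaces.
   Context: For a finite set $S=\{0=s_0<\dots<s_n\}$ of nonnegative reals, $s_i$ is a jump number if $i=n$ or $2s_i<s_{i+1}$; for consecutive jump numbers $s_i<s_j$, $S\cap(s_i,s_j]$ is a block, and $\{0\}$ is the trivial block; $x\approx y$ iff $x,y$ lie in the same block. $S$ is a compact distance set if for all $x,y\in S\setminus\{0\}$: $|x-y|\le s_1$ iff $x\approx y$. An $S$-metric space is a metric space all of whose distances lie in $S$; morphisms are isometric embeddings. $\mathcal{U}_S$ is the unique countably infinite ultrahomogeneous $S$-metric space (every isometry between finite subspaces extends to an isometry of the whole space) whose finite subspaces are, up to isometry, all finite $S$-metric spaces. A finite $\mathcal{A}$ has finite big Ramsey degree in $\mathcal{U}_S$ if there is a positive integer $t$ such that for every $k\ge2$ and every $k$-coloring of the isometric embeddings $\mathcal{A}\hookrightarrow\mathcal{U}_S$ there is an isometric embedding $w:\mathcal{U}_S\hookrightarrow\mathcal{U}_S$ such that the embeddings $w\circ f$ receive at most $t$ colors. *)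

theory Defs
  imports "HOL-Analysis.Analysis"
begin

definition distance_set :: "real set \<Rightarrow> bool" where
  "distance_set S \<longleftrightarrow> finite S \<and> 0 \<in> S \<and> (\<forall>x\<in>S. 0 \<le> x)"

definition nth_dist :: "real set \<Rightarrow> nat \<Rightarrow> real" where
  "nth_dist S i = sorted_list_of_set S ! i"

definition jump_number :: "real set \<Rightarrow> real \<Rightarrow> bool" where
  "jump_number S x \<longleftrightarrow>
     (\<exists>i < card S. x = nth_dist S i \<and>
        (i = card S - 1 \<or> 2 * nth_dist S i < nth_dist S (i + 1)))"

definition consecutive_jumps :: "real set \<Rightarrow> real \<Rightarrow> real \<Rightarrow> bool" where
  "consecutive_jumps S a b \<longleftrightarrow>
     jump_number S a \<and> jump_number S b \<and> a < b \<and> \<not> (\<exists>c. jump_number S c \<and> a < c \<and> c < b)"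

definition nontrivial_blocks :: "real set \<Rightarrow> real set set" where
  "nontrivial_blocks S = {S \<inter> {a<..b} | a b. consecutive_jumps S a b}"

definition blocks :: "real set \<Rightarrow> real set set" where
  "blocks S = insert {0} (nontrivial_blocks S)"

definition same_block :: "real set \<Rightarrow> real \<Rightarrow> real \<Rightarrow> bool" where
  "same_block S x y \<longleftrightarrow> (\<exists>B\<in>blocks S. x \<in> B \<and> y \<in> B)"

definition compact_distance_set :: "real set \<Rightarrow> bool" where
  "compact_distance_set S \<longleftrightarrow>
     distance_set S \<and>
     (\<forall>x\<in>S - {0}. \<forall>y\<in>S - {0}. \<bar>x - y\<bar> \<le> nth_dist S 1 \<longleftrightarrow> same_block S x y)"

definition S_metric_space :: "real set \<Rightarrow> 'a set \<Rightarrow> ('a \<Rightarrow> 'a \<Rightarrow> real) \<Rightarrow> bool" where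
  "S_metric_space S M d \<longleftrightarrow> Metric_space M d \<and> (\<forall>x\<in>M. \<forall>y\<in>M. d x y \<in> S)"

text \<open>Maps are extensional (\<open>undefined\<close> off the source carrier), so that distinct elements of
  the set below are distinct as maps on the carrier.  Injectivity is automatic between metric
  spaces.\<close>

definition isometric_embeddings ::
    "'a set \<Rightarrow> ('a \<Rightarrow> 'a \<Rightarrow> real) \<Rightarrow> 'b set \<Rightarrow> ('b \<Rightarrow> 'b \<Rightarrow> real) \<Rightarrow> ('a \<Rightarrow> 'b) set" where
  "isometric_embeddings M d N e =
     {f \<in> M \<rightarrow>\<^sub>E N. \<forall>x\<in>M. \<forall>y\<in>M. e (f x) (f y) = d x y}"

definition isometries ::
    "'a set \<Rightarrow> ('a \<Rightarrow> 'a \<Rightarrow> real) \<Rightarrow> 'b set \<Rightarrow> ('b \<Rightarrow> 'b \<Rightarrow> real) \<Rightarrow> ('a \<Rightarrow> 'b) set" where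
  "isometries M d N e = {f \<in> isometric_embeddings M d N e. f ` M = N}"

definition ultrahomogeneous :: "'a set \<Rightarrow> ('a \<Rightarrow> 'a \<Rightarrow> real) \<Rightarrow> bool" where
  "ultrahomogeneous U d \<longleftrightarrow>
     (\<forall>F G. finite F \<and> F \<subseteq> U \<and> finite G \<and> G \<subseteq> U \<longrightarrow>
        (\<forall>f\<in>isometries F d G d. \<exists>g\<in>isometries U d U d. \<forall>x\<in>F. g x = f x))"

text \<open>In the last clause of the next definition, finite \<open>S\<close>-metric spaces with carrier in
  \<^typ>\<open>nat\<close> represent all finite \<open>S\<close>-metric spaces up to isometry; conversely, every finite subspace
  of \<open>U\<close> is an \<open>S\<close>-metric space by the first clause.\<close>

definition is_Fraisse_limit :: "real set \<Rightarrow> 'u set \<Rightarrow> ('u \<Rightarrow> 'u \<Rightarrow> real) \<Rightarrow> bool" where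
  "is_Fraisse_limit S U d \<longleftrightarrow>
     S_metric_space S U d \<and> countable U \<and> infinite U \<and> ultrahomogeneous U d \<and>
     (\<forall>(A :: nat set) dA. finite A \<and> S_metric_space S A dA \<longrightarrow>
        (\<exists>F. finite F \<and> F \<subseteq> U \<and> isometries A dA F d \<noteq> {}))"

definition finite_big_Ramsey_degree ::
    "'a set \<Rightarrow> ('a \<Rightarrow> 'a \<Rightarrow> real) \<Rightarrow> 'u set \<Rightarrow> ('u \<Rightarrow> 'u \<Rightarrow> real) \<Rightarrow> bool" where
  "finite_big_Ramsey_degree A dA U d \<longleftrightarrow>
     (\<exists>t::nat. t > 0 \<and>
       (\<forall>k::nat. k \<ge> 2 \<longrightarrow>
         (\<forall>c \<in> isometric_embeddings A dA U d \<rightarrow> {..<k}.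
           \<exists>w \<in> isometric_embeddings U d U d.
             card ((\<lambda>f. c (compose A w f)) ` isometric_embeddings A dA U d) \<le> t)))"

end

theory Submission
  imports Defs
begin

text \<open>
  With one nontrivial block, \<open>x \<le> y + z\<close> holds for all nonzero distances, so \<open>U\<close> is the universal
  homogeneous complete graph with edges coloured by the \<open>s\<close> nonzero distances. It embeds into,
  and contains a copy of, the set of finite words over an \<open>s\<close>-letter alphabet, where a shorter word \<open>u\<close>
  and a longer word \<open>v\<close> have the distance named by the letter of \<open>v\<close> at position \<open>length u\<close>. Substitution
  of words into an infinite parameter word is a self-embedding of this graph.

  Every tuple of words arises from a finite parameter word, whose number of parameters is bounded
  in terms of the size of the tuple, by one of boundedly many decodings. Hence it suffices that for
  every finite colouring of the \<open>k\<close>-parameter words there is an infinite parameter word such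
  that all substitutions of \<open>k\<close>-parameter words into it have the same colour. For \<open>k = 0\<close> this is the
  Carlson--Simpson theorem, proved with idempotent ultrafilters. The step from \<open>k\<close> to \<open>k + 1\<close> treats the
  first parameter as a new letter and fuses countably many applications of the case \<open>k\<close>.
\<close>

section \<open>Compact semigroups and ultrafilters on words\<close>

text \<open>The obstacle in the step from \<open>k\<close> to \<open>k + 1\<close>: the first
  parameter can be read as a letter only behind a fixed prefix \<open>u\<close> of letters, and
  there are infinitely many such prefixes. But only finitely many have a given length, so one
  application of case \<open>k\<close> to a product colouring treats all of them, and it can be
  arranged to leave everything up to that length alone. This is why the fusion converges. Afterwards
  the colour depends on \<open>u\<close> only, and the Carlson-Simpson theorem removes this
  dependence. The bound on the number of colours does not involve the colouring: a
  \<open>k\<close>-parameter word is coloured by the colours of all tuples decoded from it at once,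
  and after homogenization the colour of a tuple is determined by \<open>k\<close> and its
  decoding.\<close>

lemma compact_imp_closed_fun_bool:
  fixes X :: "('a \<Rightarrow> bool) set"
  assumes "compact X"
  shows "closed X"
proof -
  have Hausdorff: "Hausdorff_space (euclidean :: bool topology)"
    by (simp add: Hausdorff_space_def disjnt_def) (metis hausdorff)
  have "Hausdorff_space (product_topology (\<lambda>_::'a. euclidean :: bool topology) UNIV)"
    by (simp add: Hausdorff_space_product_topology Hausdorff)
  then have "Hausdorff_space (euclidean :: ('a \<Rightarrow> bool) topology)"
    by (simp add: euclidean_product_topology)
  then show ?thesis
    using assms compactin_imp_closedin by fastforce
qed

text \<open>Zorn's lemma on complements, where minimal sets become maximal. The intersection of a
  chain stays nonempty by the finite intersection property, and \<open>Inter\<close> keeps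
  \<open>P\<close>; \<open>kc\<close> stands in for the Hausdorff property.\<close>

lemma compact_minimal_subset:
  fixes K :: "'a::topological_space set"
  assumes kc: "\<And>X :: 'a set. compact X \<Longrightarrow> closed X"
    and K: "compact K" "K \<noteq> {}" "P K"
    and Inter: "\<And>\<C>. \<C> \<noteq> {} \<Longrightarrow> (\<forall>C\<in>\<C>. C \<subseteq> K \<and> P C) \<Longrightarrow> P (\<Inter>\<C>)"
  obtains M where "M \<subseteq> K" "compact M" "M \<noteq> {}" "P M"
    "\<And>X. X \<subseteq> M \<Longrightarrow> compact X \<Longrightarrow> X \<noteq> {} \<Longrightarrow> P X \<Longrightarrow> X = M"
proof -
  define \<F> where "\<F> = {X. X \<subseteq> K \<and> compact X \<and> X \<noteq> {} \<and> P X}"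
  have "\<exists>M\<in>uminus ` \<F>. \<forall>X\<in>uminus ` \<F>. M \<subseteq> X \<longrightarrow> X = M"
  proof (rule subset_Zorn_nonempty)
    show "uminus ` \<F> \<noteq> {}"
      using K by (auto simp: \<F>_def)
  next
    fix \<C> assume ne: "\<C> \<noteq> {}" and ch: "subset.chain (uminus ` \<F>) \<C>"
    define \<D> where "\<D> = uminus ` \<C>"
    have \<D>: "\<D> \<noteq> {}" "\<D> \<subseteq> \<F>"
      using ne ch by (auto simp: \<D>_def subset.chain_def)
    have chD: "\<And>X Y. X \<in> \<D> \<Longrightarrow> Y \<in> \<D> \<Longrightarrow> X \<subseteq> Y \<or> Y \<subseteq> X"
      using ch unfolding \<D>_def subset.chain_def by blast
    have fin: "\<exists>X\<in>\<D>. X \<subseteq> \<Inter>F" if "finite F" "F \<noteq> {}" "F \<subseteq> \<D>" for F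
      using that
    proof (induction F rule: finite_ne_induct)
      case (singleton x)
      then show ?case by auto
    next
      case (insert x F)
      then obtain X where "X \<in> \<D>" "X \<subseteq> \<Inter>F" by auto
      moreover have "x \<in> \<D>" using insert by auto
      ultimately show ?case using chD[of X x] by auto
    qed
    obtain D0 where D0: "D0 \<in> \<D>" using \<D> by auto
    have cl: "closed X" if "X \<in> \<D>" for X
      using that \<D> by (auto simp: \<F>_def intro: kc)
    have "D0 \<inter> \<Inter>\<D> \<noteq> {}"
    proof (rule compact_imp_fip)
      show "compact D0" using D0 \<D> by (auto simp: \<F>_def)
      show "closed T" if "T \<in> \<D>" for T using cl that by auto
      fix F assume "finite F" "F \<subseteq> \<D>"
      then obtain X where "X \<in> \<D>" "X \<subseteq> \<Inter>(insert D0 F)"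
        using fin[of "insert D0 F"] D0 by auto
      moreover from this have "X \<noteq> {}"
        using \<D> by (auto simp: \<F>_def)
      ultimately show "D0 \<inter> \<Inter>F \<noteq> {}"
        by blast
    qed
    moreover have "P (\<Inter>\<D>)"
      using \<D> by (intro Inter) (auto simp: \<F>_def)
    moreover have "\<Inter>\<D> \<subseteq> K"
      using D0 \<D> by (auto simp: \<F>_def)
    moreover have "compact (\<Inter>\<D>)"
      using cl K \<open>\<Inter>\<D> \<subseteq> K\<close> compact_Int_closed[of K "\<Inter>\<D>"] by (auto simp: inf.absorb2)
    ultimately have "\<Inter>\<D> \<in> \<F>"
      by (auto simp: \<F>_def)
    moreover have "\<Union>\<C> = - \<Inter>\<D>"
      by (auto simp: \<D>_def)
    ultimately show "\<Union>\<C> \<in> uminus ` \<F>"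
      by auto
  qed
  then obtain M where M: "M \<in> \<F>" "\<forall>X\<in>\<F>. - M \<subseteq> - X \<longrightarrow> - X = - M"
    by auto
  show thesis
  proof (rule that[of M])
    fix X assume "X \<subseteq> M" "compact X" "X \<noteq> {}" "P X"
    then show "X = M"
      using M by (auto simp: \<F>_def)
  qed (use M in \<open>auto simp: \<F>_def\<close>)
qed

text \<open>The Ellis-Numakura argument: in a minimal compact subsemigroup \<open>T\<close> with
  \<open>e \<in> T\<close>, both \<open>T e\<close> and \<open>{x \<in> T. x e = e}\<close> are
  compact subsemigroups, hence all of \<open>T\<close>. Compactness of both comes from continuity in
  the left factor.\<close>

lemma compact_semigroup_idempotent:
  fixes K :: "'a::topological_space set" and m :: "'a \<Rightarrow> 'a \<Rightarrow> 'a"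
  assumes kc: "\<And>X :: 'a set. compact X \<Longrightarrow> closed X"
    and K: "compact K" "K \<noteq> {}"
    and closed: "\<And>x y. x \<in> K \<Longrightarrow> y \<in> K \<Longrightarrow> m x y \<in> K"
    and assoc: "\<And>x y z. m (m x y) z = m x (m y z)"
    and cont: "\<And>y. continuous_on K (\<lambda>x. m x y)"
  obtains e where "e \<in> K" "m e e = e"
proof -
  obtain T where T: "T \<subseteq> K" "compact T" "T \<noteq> {}" "\<forall>x\<in>T. \<forall>y\<in>T. m x y \<in> T"
    and min: "\<And>X. X \<subseteq> T \<Longrightarrow> compact X \<Longrightarrow> X \<noteq> {} \<Longrightarrow> (\<forall>x\<in>X. \<forall>y\<in>X. m x y \<in> X) \<Longrightarrow> X = T"
    by (rule compact_minimal_subset[of K "\<lambda>T. \<forall>x\<in>T. \<forall>y\<in>T. m x y \<in> T"])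
       (use kc K closed in auto)
  obtain e where e: "e \<in> T"
    using T by auto
  have cT: "continuous_on T (\<lambda>x. m x y)" for y
    using cont T(1) continuous_on_subset by blast
  have img: "(\<lambda>x. m x e) ` T = T"
  proof (rule min)
    show "\<forall>x\<in>(\<lambda>x. m x e) ` T. \<forall>y\<in>(\<lambda>x. m x e) ` T. m x y \<in> (\<lambda>x. m x e) ` T"
    proof (clarsimp simp: assoc)
      fix x y assume "x \<in> T" "y \<in> T"
      then have "m x (m e (m y e)) = m (m x (m e y)) e" "m x (m e y) \<in> T"
        using T(4) e by (auto simp: assoc)
      then show "m x (m e (m y e)) \<in> (\<lambda>x. m x e) ` T" by auto
    qed
  qed (use T e cT in \<open>auto intro!: compact_continuous_image\<close>)
  define X where "X = {x \<in> T. m x e = e}"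
  have "X = T"
  proof (rule min)
    show "compact X"
    proof -
      have "closedin (top_of_set T) (T \<inter> (\<lambda>x. m x e) -` {e})"
        using cT kc[of "{e}"] by (auto intro: continuous_closedin_preimage)
      then show ?thesis
        using T(2) by (auto simp: X_def vimage_def Int_def intro: closedin_compact)
    qed
    show "X \<noteq> {}"
      using img e by (auto simp: X_def) (metis imageE)
    show "\<forall>x\<in>X. \<forall>y\<in>X. m x y \<in> X"
      using T(4) by (auto simp: X_def assoc)
  qed (auto simp: X_def)
  then have "m e e = e"
    using e by (auto simp: X_def)
  with e T show thesis
    using that by blast
qed

text \<open>For \<open>f\<close> in the minimal left ideal \<open>L\<close>, the set
  \<open>K f\<close> is a compact left ideal inside \<open>L\<close>, so it is \<open>L\<close>.
  Thus each \<open>e \<in> L\<close> is a multiple \<open>y f\<close>, and an idempotent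
  \<open>f\<close> on the right fixes it.\<close>

lemma compact_semigroup_minimal_left_ideal:
  fixes K :: "'a::topological_space set" and m :: "'a \<Rightarrow> 'a \<Rightarrow> 'a"
  assumes kc: "\<And>X :: 'a set. compact X \<Longrightarrow> closed X"
    and K: "compact K" "K \<noteq> {}"
    and closed: "\<And>x y. x \<in> K \<Longrightarrow> y \<in> K \<Longrightarrow> m x y \<in> K"
    and assoc: "\<And>x y z. m (m x y) z = m x (m y z)"
    and cont: "\<And>y. continuous_on K (\<lambda>x. m x y)"
  obtains L where "L \<subseteq> K" "L \<noteq> {}" "\<And>x y. x \<in> K \<Longrightarrow> y \<in> L \<Longrightarrow> m x y \<in> L"
    "\<And>e f. e \<in> L \<Longrightarrow> f \<in> L \<Longrightarrow> m f f = f \<Longrightarrow> m e f = e"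
proof -
  obtain L where L: "L \<subseteq> K" "compact L" "L \<noteq> {}" "\<forall>x\<in>K. \<forall>y\<in>L. m x y \<in> L"
    and min: "\<And>X. X \<subseteq> L \<Longrightarrow> compact X \<Longrightarrow> X \<noteq> {} \<Longrightarrow> (\<forall>x\<in>K. \<forall>y\<in>X. m x y \<in> X) \<Longrightarrow> X = L"
    by (rule compact_minimal_subset[of K "\<lambda>L. \<forall>x\<in>K. \<forall>y\<in>L. m x y \<in> L"])
       (use kc K closed in auto)
  have "m e f = e" if ef: "e \<in> L" "f \<in> L" "m f f = f" for e f
  proof -
    have "(\<lambda>x. m x f) ` K = L"
    proof (rule min)
      show "\<forall>x\<in>K. \<forall>y\<in>(\<lambda>x. m x f) ` K. m x y \<in> (\<lambda>x. m x f) ` K"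
        using closed by (auto simp: assoc[symmetric])
    qed (use K L that cont in \<open>auto intro!: compact_continuous_image\<close>)
    then obtain y where "e = m y f"
      using ef by blast
    then show ?thesis
      using that by (simp add: assoc)
  qed
  with L show thesis
    using that[of L] by blast
qed

text \<open>An ultrafilter is coded by its characteristic function on sets, which makes these a
  subspace of a product of two-point spaces and lets compactness come from Tychonoff's
  theorem.\<close>

definition ultrafilters :: "('a set \<Rightarrow> bool) set" where
  "ultrafilters = {p. (\<forall>A B. p (A \<inter> B) \<longleftrightarrow> p A \<and> p B) \<and> (\<forall>A. p (- A) \<longleftrightarrow> \<not> p A)}"

lemma ultrafilter_Int: "p \<in> ultrafilters \<Longrightarrow> p (A \<inter> B) \<longleftrightarrow> p A \<and> p B"
  and ultrafilter_Compl: "p \<in> ultrafilters \<Longrightarrow> p (- A) \<longleftrightarrow> \<not> p A"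
  by (auto simp: ultrafilters_def)

lemma ultrafilter_empty: "p \<in> ultrafilters \<Longrightarrow> \<not> p {}"
  using ultrafilter_Int[of p _ "- _"] ultrafilter_Compl[of p] by (metis Compl_disjoint)

lemma ultrafilter_UNIV: "p \<in> ultrafilters \<Longrightarrow> p UNIV"
  using ultrafilter_Compl[of p "{}"] ultrafilter_empty[of p] by simp

lemma ultrafilter_mono: "p \<in> ultrafilters \<Longrightarrow> p A \<Longrightarrow> A \<subseteq> B \<Longrightarrow> p B"
  using ultrafilter_Int[of p A B] by (simp add: inf.absorb1)

lemma ultrafilter_Un: "p \<in> ultrafilters \<Longrightarrow> p (A \<union> B) \<longleftrightarrow> p A \<or> p B"
  using ultrafilter_Compl[of p] ultrafilter_Int[of p] by (metis Compl_Un)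

lemma ultrafilter_nonempty: "p \<in> ultrafilters \<Longrightarrow> p A \<Longrightarrow> \<exists>x. x \<in> A"
  using ultrafilter_empty by (metis ex_in_conv)

lemma ultrafilter_finite_INT:
  "finite I \<Longrightarrow> p \<in> ultrafilters \<Longrightarrow> p (\<Inter>i\<in>I. A i) \<longleftrightarrow> (\<forall>i\<in>I. p (A i))"
  by (induction I rule: finite_induct) (auto simp: ultrafilter_UNIV ultrafilter_Int)

lemma ultrafilter_finite_UN:
  "finite I \<Longrightarrow> p \<in> ultrafilters \<Longrightarrow> p (\<Union>i\<in>I. A i) \<longleftrightarrow> (\<exists>i\<in>I. p (A i))"
  by (induction I rule: finite_induct) (auto simp: ultrafilter_empty ultrafilter_Un)

lemma principal_ultrafilter: "(\<lambda>A. x \<in> A) \<in> ultrafilters"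
  by (auto simp: ultrafilters_def)

section \<open>The compact space of ultrafilters and concatenation on it\<close>

lemma
  shows closed_Collect_coord: "closed {p :: 'a \<Rightarrow> bool. p A}"
    and closed_Collect_not_coord: "closed {p :: 'a \<Rightarrow> bool. \<not> p A}"
proof -
  have "closed ((\<lambda>p :: 'a \<Rightarrow> bool. p A) -` {True})" "closed ((\<lambda>p :: 'a \<Rightarrow> bool. p A) -` {False})"
    by (auto intro!: closed_vimage)
  then show "closed {p :: 'a \<Rightarrow> bool. p A}" "closed {p :: 'a \<Rightarrow> bool. \<not> p A}"
    by (auto simp: vimage_def)
qed

lemma compact_UNIV_fun_bool: "compact (UNIV :: ('a \<Rightarrow> bool) set)"
proof -
  have "compact_space (product_topology (\<lambda>_::'a. euclidean :: bool topology) UNIV)"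
    unfolding compact_space_product_topology by (auto simp: compact_space_def intro: finite_imp_compact)
  then show ?thesis
    by (simp add: euclidean_product_topology compact_space_def)
qed

lemma compact_ultrafilters_containing: "compact {p \<in> ultrafilters. p A}"
proof -
  \<comment> \<open>Rewritten with single coordinates and their negations, joined by conjunction and
    disjunction, so that each condition is visibly closed.\<close>
  have "{p \<in> ultrafilters. p A} = {p. (\<forall>A B. (p (A \<inter> B) \<and> p A \<and> p B) \<or> (\<not> p (A \<inter> B) \<and> (\<not> p A \<or> \<not> p B))) \<and>
      (\<forall>A. (p (- A) \<and> \<not> p A) \<or> (\<not> p (- A) \<and> p A)) \<and> p A}"
    by (auto simp: ultrafilters_def)
  moreover have "closed \<dots>"
    by (intro closed_Collect_conj closed_Collect_all closed_Collect_disj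
        closed_Collect_coord closed_Collect_not_coord)
  ultimately show ?thesis
    using compact_Int_closed[OF compact_UNIV_fun_bool] by (metis inf_top_left)
qed

text \<open>The extension of concatenation to ultrafilters: for \<open>p\<close>-most
  \<open>x\<close> and then \<open>q\<close>-most \<open>y\<close>, the word \<open>x @ y\<close>
  lies in \<open>A\<close>. With \<open>q\<close> and \<open>A\<close> fixed this evaluates
  \<open>p\<close> at one fixed set, whence the continuity in the left factor.\<close>

definition uconcat :: "('a list set \<Rightarrow> bool) \<Rightarrow> ('a list set \<Rightarrow> bool) \<Rightarrow> 'a list set \<Rightarrow> bool" where
  "uconcat p q = (\<lambda>A. p {x. q {y. x @ y \<in> A}})"

lemma uconcat_assoc: "uconcat (uconcat p q) r = uconcat p (uconcat q r)"
  by (simp add: uconcat_def)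

lemma uconcat_ultrafilter:
  assumes "p \<in> ultrafilters" "q \<in> ultrafilters"
  shows "uconcat p q \<in> ultrafilters"
proof -
  have "{x. q {y. x @ y \<in> A \<inter> B}} = {x. q {y. x @ y \<in> A}} \<inter> {x. q {y. x @ y \<in> B}}" for A B
    using ultrafilter_Int[OF assms(2), of "{y. _ @ y \<in> A}" "{y. _ @ y \<in> B}"] by (auto simp: Collect_conj_eq)
  moreover have "{x. q {y. x @ y \<in> - A}} = - {x. q {y. x @ y \<in> A}}" for A
    using ultrafilter_Compl[OF assms(2), of "{y. _ @ y \<in> A}"] by (auto simp: Compl_eq)
  ultimately show ?thesis
    using assms unfolding ultrafilters_def uconcat_def by (auto simp del: Int_iff Compl_iff)
qed

lemma continuous_on_uconcat_left: "continuous_on K (\<lambda>p. uconcat p q)"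
  unfolding uconcat_def by (intro continuous_on_coordinatewise_then_product)
   (auto intro: continuous_on_subset[OF continuous_on_product_coordinates])

definition umap :: "('a \<Rightarrow> 'b) \<Rightarrow> ('a set \<Rightarrow> bool) \<Rightarrow> 'b set \<Rightarrow> bool" where
  "umap f p = (\<lambda>A. p (f -` A))"

lemma umap_ultrafilter: "p \<in> ultrafilters \<Longrightarrow> umap f p \<in> ultrafilters"
  by (simp add: ultrafilters_def umap_def vimage_Compl)

lemma umap_uconcat:
  assumes "\<And>x y. f (x @ y) = f x @ f y"
  shows "umap f (uconcat p q) = uconcat (umap f p) (umap f q)"
  by (simp add: umap_def uconcat_def vimage_def assms)

section \<open>Left variable words\<close>

definition vsub :: "nat \<Rightarrow> nat \<Rightarrow> nat list \<Rightarrow> nat list" where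
  "vsub s a = map (\<lambda>c. if c = s then a else c)"

lemma vsub_append: "vsub s a (x @ y) = vsub s a x @ vsub s a y"
  by (simp add: vsub_def)

lemma vsub_ident: "x \<in> lists {..<s} \<Longrightarrow> vsub s a x = x"
  unfolding vsub_def by (rule map_idI) auto

lemma vsub_in_lists: "x \<in> lists {..s} \<Longrightarrow> a < s \<Longrightarrow> vsub s a x \<in> lists {..<s}"
  by (force simp: vsub_def in_lists_conv_set)

lemma umap_eqI:
  assumes "p \<in> ultrafilters" "p X" "\<And>x. x \<in> X \<Longrightarrow> f x = x"
  shows "umap f p = p"
proof
  fix A
  have "p (f -` A) \<longleftrightarrow> p (f -` A \<inter> X)"
    using assms by (simp add: ultrafilter_Int)
  also have "f -` A \<inter> X = A \<inter> X"
    using assms by auto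
  also have "p \<dots> \<longleftrightarrow> p A"
    using assms by (simp add: ultrafilter_Int)
  finally show "umap f p A = p A"
    by (simp add: umap_def)
qed

lemma uconcat_contains:
  assumes "p \<in> ultrafilters" "q \<in> ultrafilters" "p X" "q Y"
    and "\<And>x y. x \<in> X \<Longrightarrow> y \<in> Y \<Longrightarrow> x @ y \<in> Z"
  shows "uconcat p q Z"
  unfolding uconcat_def
proof (rule ultrafilter_mono[OF assms(1,3)], rule subsetI, rule CollectI)
  fix x assume "x \<in> X"
  then show "q {y. x @ y \<in> Z}"
    using assms(5) by (intro ultrafilter_mono[OF assms(2,4)]) auto
qed

text \<open>
  Let \<open>L\<close> be a minimal left ideal of the ultrafilters on words over \<open>{..<s}\<close> and \<open>p \<in> L\<close>.
  The ultrafilters \<open>x p\<close>, with \<open>x\<close> concentrated on words beginning with the variable \<open>s\<close>, form a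
  compact semigroup. The substitution instances of an idempotent in it are idempotents of the one
  minimal left ideal \<open>L\<close>, so any two of them multiply to the left factor.
\<close>

lemma left_zero_substitutions:
  fixes s :: nat
  obtains q where "q \<in> ultrafilters" "q {v \<in> lists {..s}. v \<noteq> [] \<and> hd v = s}"
    "\<And>a b. a < s \<Longrightarrow> b < s \<Longrightarrow>
       uconcat (umap (vsub s a) q) (umap (vsub s b) q) = umap (vsub s a) q"
proof -
  define M where "M = {p \<in> ultrafilters. p (lists {..<s})}"
  define V where "V = {v \<in> lists {..s}. v \<noteq> [] \<and> hd v = s}"
  define VU where "VU = {p \<in> ultrafilters. p V}"
  have M_mult: "uconcat p q \<in> M" if "p \<in> M" "q \<in> M" for p q
    using that uconcat_contains[of p q "lists {..<s}" "lists {..<s}" "lists {..<s}"]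
    by (auto simp: M_def uconcat_ultrafilter)
  have M_ne: "M \<noteq> {}"
    using principal_ultrafilter[of "[]"] by (auto simp: M_def intro!: exI[of _ "\<lambda>A. [] \<in> A"])
  obtain L where L: "L \<subseteq> M" "L \<noteq> {}" "\<And>x y. x \<in> M \<Longrightarrow> y \<in> L \<Longrightarrow> uconcat x y \<in> L"
    and L0: "\<And>e f. e \<in> L \<Longrightarrow> f \<in> L \<Longrightarrow> uconcat f f = f \<Longrightarrow> uconcat e f = e"
    by (rule compact_semigroup_minimal_left_ideal[of M uconcat])
       (use M_ne M_mult in \<open>auto simp: uconcat_assoc continuous_on_uconcat_left
          compact_imp_closed_fun_bool M_def compact_ultrafilters_containing\<close>)
  obtain p where p: "p \<in> L"
    using L by auto
  then have pM: "p \<in> M"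
    using L by auto
  \<comment> \<open>Apart from the alphabet, membership in \<open>V\<close> depends on the first
    letter only, so \<open>VU\<close> is closed under multiplication from the right.\<close>
  have VU_mult: "uconcat x r \<in> VU" if "x \<in> VU" "r \<in> ultrafilters" "r (lists {..s})" for x r
    using that uconcat_contains[of x r V "lists {..s}" V]
    by (auto simp: VU_def V_def uconcat_ultrafilter)
  have pN: "p \<in> ultrafilters" "p (lists {..s})"
    using pM by (auto simp: M_def elim!: ultrafilter_mono)
  define K where "K = (\<lambda>x. uconcat x p) ` VU"
  have "compact K"
    unfolding K_def VU_def
    by (intro compact_continuous_image continuous_on_uconcat_left compact_ultrafilters_containing)
  have "(\<lambda>A. [s] \<in> A) \<in> VU"
    by (auto simp: VU_def V_def principal_ultrafilter)
  then have "K \<noteq> {}"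
    by (auto simp: K_def)
  \<comment> \<open>\<open>(x' p) (y' p) = (x' (p y')) p\<close>, and the left factor begins with
    the variable because \<open>x'\<close> does.\<close>
  have K_mult: "uconcat x y \<in> K" if xy: "x \<in> K" "y \<in> K" for x y
  proof -
    obtain x' y' where *: "x = uconcat x' p" "y = uconcat y' p" "x' \<in> VU" "y' \<in> VU"
      using xy by (auto simp: K_def)
    have "y' \<in> ultrafilters" "y' (lists {..s})"
      using * by (auto simp: VU_def V_def elim!: ultrafilter_mono)
    then have "uconcat p y' \<in> ultrafilters" "uconcat p y' (lists {..s})"
      using pN uconcat_contains[of p y' "lists {..s}" "lists {..s}" "lists {..s}"]
      by (auto simp: uconcat_ultrafilter)
    then have "uconcat x' (uconcat p y') \<in> VU"
      using * VU_mult by blast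
    moreover have "uconcat x y = uconcat (uconcat x' (uconcat p y')) p"
      by (simp add: * uconcat_assoc)
    ultimately show ?thesis
      by (auto simp: K_def)
  qed
  obtain q where q: "q \<in> K" "uconcat q q = q"
    by (rule compact_semigroup_idempotent[of K uconcat])
       (use \<open>compact K\<close> \<open>K \<noteq> {}\<close> K_mult in \<open>auto simp: uconcat_assoc continuous_on_uconcat_left
          compact_imp_closed_fun_bool\<close>)
  then obtain x where x: "q = uconcat x p" "x \<in> VU"
    by (auto simp: K_def)
  have qVU: "q \<in> VU"
    using x VU_mult pN by auto
  have hom: "umap (vsub s a) (uconcat y z) = uconcat (umap (vsub s a) y) (umap (vsub s a) z)" for a y z
    by (rule umap_uconcat) (rule vsub_append)
  \<comment> \<open>Substitution fixes \<open>p\<close>, which lives on words without the variable,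
    and turns \<open>x\<close> into an element of \<open>M\<close>; so \<open>q = x p\<close> goes
    into the left ideal \<open>L\<close>.\<close>
  have inL: "umap (vsub s a) q \<in> L" if "a < s" for a
  proof -
    have "umap (vsub s a) p = p"
      using pM vsub_ident by (intro umap_eqI[of _ "lists {..<s}"]) (auto simp: M_def)
    moreover have "umap (vsub s a) x \<in> M"
    proof -
      have "x \<in> ultrafilters" "x V"
        using x by (auto simp: VU_def)
      moreover have "V \<subseteq> vsub s a -` lists {..<s}"
        using that vsub_in_lists[of _ s a] by (auto simp: V_def)
      ultimately show ?thesis
        unfolding M_def using ultrafilter_mono[of x V "vsub s a -` lists {..<s}"] umap_ultrafilter[of x "vsub s a"]
        by (simp add: umap_def)
    qed
    ultimately show ?thesis
      using L(3) p by (simp add: x hom)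
  qed
  show thesis
  proof (rule that[of q])
    show "uconcat (umap (vsub s a) q) (umap (vsub s b) q) = umap (vsub s a) q" if "a < s" "b < s" for a b
    proof (rule L0[OF inL[OF that(1)] inL[OF that(2)]])
      show "uconcat (umap (vsub s b) q) (umap (vsub s b) q) = umap (vsub s b) q"
        using hom[of b q q] q(2) by metis
    qed
  next
    show "q \<in> ultrafilters" "q {v \<in> lists {..s}. v \<noteq> [] \<and> hd v = s}"
      using qVU by (simp_all add: VU_def V_def)
  qed
qed

text \<open>\<open>B\<close> collects the words of one colour that \<open>q\<close>-most
  \<open>v\<close> extend, under every letter, within this colour. By the left-zero law of the
  substitution instances of \<open>q\<close>, these extensions lie again in \<open>B\<close>;
  finitely many words are extended by one \<open>v\<close> because \<open>q\<close> is closed under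
  finite intersections.\<close>

lemma carlson_simpson_step:
  fixes s :: nat and col :: "nat list \<Rightarrow> 'c"
  assumes s: "0 < s" and fin: "finite (col ` lists {..<s})"
  obtains B c where "B \<noteq> {}" "B \<subseteq> {w \<in> lists {..<s}. col w = c}"
    "\<And>F. finite F \<Longrightarrow> F \<subseteq> B \<Longrightarrow>
       \<exists>v \<in> lists {..s}. v \<noteq> [] \<and> hd v = s \<and> (\<forall>w\<in>F. \<forall>b<s. w @ vsub s b v \<in> B)"
proof -
  obtain q where q: "q \<in> ultrafilters" "q {v \<in> lists {..s}. v \<noteq> [] \<and> hd v = s}"
    and left_zero: "\<And>a b. a < s \<Longrightarrow> b < s \<Longrightarrow>
       uconcat (umap (vsub s a) q) (umap (vsub s b) q) = umap (vsub s a) q"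
    using left_zero_substitutions[of s] by blast
  define \<theta> where "\<theta> b = umap (vsub s b) q" for b
  have \<theta>: "\<theta> b \<in> ultrafilters" for b
    using q by (simp add: \<theta>_def umap_ultrafilter)
  have \<theta>_split: "\<theta> a {x. q {v. x @ vsub s b v \<in> A}}" if "\<theta> a A" "a < s" "b < s" for a b A
  proof -
    have "uconcat (\<theta> a) (\<theta> b) A"
      using left_zero[of a b] that by (simp add: \<theta>_def)
    then show ?thesis
      unfolding uconcat_def \<theta>_def by (simp add: umap_def vimage_def)
  qed
  have "\<theta> 0 (lists {..<s})"
    unfolding \<theta>_def umap_def using s vsub_in_lists[of _ s 0]
    by (intro ultrafilter_mono[OF q]) auto
  also have "lists {..<s} = (\<Union>c\<in>col ` lists {..<s}. {w \<in> lists {..<s}. col w = c})"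
    by auto
  finally obtain c where c: "\<theta> 0 {w \<in> lists {..<s}. col w = c}"
    unfolding ultrafilter_finite_UN[OF fin \<theta>] by blast
  define A where "A = {w \<in> lists {..<s}. col w = c}"
  define B where "B = A \<inter> (\<Inter>b\<in>{..<s}. {w. q {v. w @ vsub s b v \<in> A}})"
  \<comment> \<open>\<open>\<theta> 0 = \<theta> 0 \<theta> b\<close> shows that each of the
    finitely many conditions defining \<open>B\<close> is \<open>\<theta> 0\<close>-large.\<close>
  have "\<theta> 0 B"
    unfolding B_def using c s
    by (auto simp: ultrafilter_Int \<theta> ultrafilter_finite_INT A_def[symmetric] intro: \<theta>_split)
  then have "B \<noteq> {}"
    using ultrafilter_empty[OF \<theta>] by auto
  have ext: "q {v. w @ vsub s b v \<in> B}" if w: "w \<in> B" and b: "b < s" for w b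
  proof -
    have 1: "q {v. w @ vsub s b v \<in> A}"
      using w b by (auto simp: B_def)
    \<comment> \<open>\<open>\<theta> b = \<theta> b \<theta> a\<close>, applied to the
      continuations of \<open>w\<close> into \<open>A\<close>: what can be extended once can be
      extended twice.\<close>
    have 2: "q {v. q {v'. w @ vsub s b v @ vsub s a v' \<in> A}}" if a: "a < s" for a
    proof -
      have "\<theta> b {u. w @ u \<in> A}"
        using 1 by (simp add: \<theta>_def umap_def vimage_def)
      then have "\<theta> b {x. q {v. x @ vsub s a v \<in> {u. w @ u \<in> A}}}"
        using \<theta>_split a b by blast
      then show ?thesis
        by (simp add: \<theta>_def umap_def vimage_def)
    qed
    have "{v. w @ vsub s b v \<in> B} = {v. w @ vsub s b v \<in> A} \<inter>
       (\<Inter>a\<in>{..<s}. {v. q {v'. w @ vsub s b v @ vsub s a v' \<in> A}})"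
      by (auto simp: B_def)
    then show ?thesis
      using 1 2 q by (simp add: ultrafilter_Int ultrafilter_finite_INT)
  qed
  show thesis
  proof (rule that[of B c])
    fix F assume F: "finite F" "F \<subseteq> B"
    define X where "X = {v \<in> lists {..s}. v \<noteq> [] \<and> hd v = s} \<inter>
       (\<Inter>w\<in>F. \<Inter>b\<in>{..<s}. {v. w @ vsub s b v \<in> B})"
    have "q X"
      unfolding X_def using q F ext by (auto simp: ultrafilter_Int ultrafilter_finite_INT)
    then obtain v where "v \<in> X"
      using ultrafilter_nonempty q by blast
    then show "\<exists>v \<in> lists {..s}. v \<noteq> [] \<and> hd v = s \<and> (\<forall>w\<in>F. \<forall>b<s. w @ vsub s b v \<in> B)"
      by (auto simp: X_def)
  qed (use \<open>B \<noteq> {}\<close> in \<open>auto simp: B_def A_def\<close>)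
qed

section \<open>Parameter words\<close>

text \<open>
  A word over the alphabet \<open>{..<s}\<close> with \<open>k\<close> parameters is coded by a list of numbers below \<open>s + k\<close>:
  numbers below \<open>s\<close> are letters, and the parameters \<open>s, s + 1, \<dots>\<close> first occur in this order. Every
  word gets the extra prefix \<open>[0..<s]\<close>, and an infinite parameter word is likewise a surjection
  \<open>W\<close> that is the identity below \<open>s\<close>. Substituting \<open>w\<close> into \<open>W\<close>, and cutting off at the first
  parameter without a value, then becomes composition of functions.
\<close>

definition rigid :: "nat \<Rightarrow> (nat \<Rightarrow> nat) \<Rightarrow> bool" where
  "rigid s W \<longleftrightarrow> surj W \<and> (\<forall>i<s. W i = i) \<and> (\<forall>p. \<forall>m<W p. \<exists>q<p. W q = m)"

definition first :: "(nat \<Rightarrow> nat) \<Rightarrow> nat \<Rightarrow> nat" where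
  "first W n = (LEAST p. W p = n)"

definition act :: "nat list \<Rightarrow> (nat \<Rightarrow> nat) \<Rightarrow> nat list" where
  "act w W = map (\<lambda>p. w ! W p) [0..<first W (length w)]"

definition words :: "nat \<Rightarrow> nat \<Rightarrow> nat list set" where
  "words s k = {w. s \<le> length w \<and> (\<forall>i<s. w ! i = i) \<and> set w = {..<s + k} \<and>
     (\<forall>p<length w. \<forall>m<w ! p. \<exists>q<p. w ! q = m)}"

section \<open>The monoid of infinite parameter words and its action on words\<close>

lemma rigidD:
  assumes "rigid s W"
  shows "surj W" "i < s \<Longrightarrow> W i = i" "m < W p \<Longrightarrow> \<exists>q<p. W q = m"
  using assms by (simp_all add: rigid_def)

lemma wordsD:
  assumes "w \<in> words s k"
  shows "s \<le> length w" "i < s \<Longrightarrow> w ! i = i" "set w = {..<s + k}"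
    "p < length w \<Longrightarrow> m < w ! p \<Longrightarrow> \<exists>q<p. w ! q = m"
proof -
  note * = assms[unfolded words_def mem_Collect_eq]
  show "s \<le> length w" "set w = {..<s + k}"
    using * by iprover+
  show "i < s \<Longrightarrow> w ! i = i"
    by (rule *[THEN conjunct2, THEN conjunct1, rule_format])
  show "p < length w \<Longrightarrow> m < w ! p \<Longrightarrow> \<exists>q<p. w ! q = m"
    by (rule *[THEN conjunct2, THEN conjunct2, THEN conjunct2, rule_format])
qed

lemma rigid_mono: "rigid t W \<Longrightarrow> s \<le> t \<Longrightarrow> rigid s W"
  by (simp add: rigid_def)

lemma rigid_id: "rigid s id"
  by (auto simp: rigid_def)

lemma first_le: "W p = n \<Longrightarrow> first W n \<le> p"
  by (simp add: first_def Least_le)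

lemma at_first: "rigid s W \<Longrightarrow> W (first W n) = n"
  using LeastI_ex[of "\<lambda>p. W p = n"] rigidD(1)[of s W] unfolding first_def surj_def by metis

text \<open>New values occur in increasing order, so a value above \<open>n\<close> would force an
  earlier \<open>n\<close>. This keeps the lookup \<open>w ! W p\<close> in \<open>act\<close>
  within range.\<close>

lemma less_first:
  assumes "rigid s W" "p < first W n"
  shows "W p < n"
proof (rule ccontr)
  assume "\<not> W p < n"
  then have "n < W p \<or> n = W p"
    by auto
  then obtain q where "q \<le> p" "W q = n"
    using rigidD(3)[OF assms(1), of n p] by (metis less_imp_le order_refl)
  then show False
    using first_le[of W q n] assms(2) by simp
qed

lemma first_strict_mono:
  assumes "rigid s W"
  shows "strict_mono (first W)"
proof (rule strict_monoI)
  fix m n :: nat assume "m < n"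
  then obtain q where "q < first W n" "W q = m"
    using rigidD(3)[OF assms, of m "first W n"] at_first[OF assms, of n] by metis
  then show "first W m < first W n"
    using first_le[of W q m] by simp
qed

lemma le_first: "rigid s W \<Longrightarrow> n \<le> first W n"
  by (rule strict_mono_imp_increasing[OF first_strict_mono])

lemma rigid_le: "rigid s W \<Longrightarrow> W p \<le> p"
  using le_first[of s W "W p"] first_le[of W p "W p"] by simp

lemma le_first_rigid:
  assumes "rigid s W" "s \<le> n"
  shows "s \<le> first W n"
  using le_first[OF assms(1), of n] assms(2) by simp

lemma firstI:
  assumes "W p = n" "\<And>q. q < p \<Longrightarrow> W q \<noteq> n"
  shows "first W n = p"
  unfolding first_def
proof (rule Least_equality[where P = "\<lambda>q. W q = n"])
  show "p \<le> q" if "W q = n" for q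
    using assms(2)[of q] that by (cases "q < p") auto
qed (rule assms(1))

text \<open>\<open>W\<close> must first reach the value \<open>first V n\<close> before
  \<open>V \<circ> W\<close> can show \<open>n\<close>; hence \<open>first\<close> reverses the
  order of composition.\<close>

lemma rigid_comp:
  assumes "rigid s V" "rigid s W"
  shows "rigid s (V \<circ> W)" "first (V \<circ> W) n = first W (first V n)"
proof -
  show "rigid s (V \<circ> W)"
    unfolding rigid_def
  proof (intro conjI allI impI)
    show "surj (V \<circ> W)"
      by (rule comp_surj[OF rigidD(1)[OF assms(2)] rigidD(1)[OF assms(1)]])
    show "(V \<circ> W) i = i" if "i < s" for i
      using assms that by (simp add: rigidD(2))
    fix p m assume "m < (V \<circ> W) p"
    then obtain q where "q < W p" "V q = m"
      using rigidD(3)[OF assms(1), of m "W p"] by auto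
    moreover from this obtain r where "r < p" "W r = q"
      using rigidD(3)[OF assms(2)] by blast
    ultimately show "\<exists>q<p. (V \<circ> W) q = m"
      by auto
  qed
  show "first (V \<circ> W) n = first W (first V n)"
  proof (rule firstI)
    show "(V \<circ> W) (first W (first V n)) = n"
      using assms by (simp add: at_first)
    fix q assume "q < first W (first V n)"
    then have "W q < first V n"
      by (rule less_first[OF assms(2)])
    then show "(V \<circ> W) q \<noteq> n"
      using less_first[OF assms(1), of "W q" n] by simp
  qed
qed

lemma length_act [simp]: "length (act w W) = first W (length w)"
  by (simp add: act_def)

lemma nth_act: "p < first W (length w) \<Longrightarrow> act w W ! p = w ! W p"
  by (simp add: act_def)

text \<open>\<open>act\<close> is composition, so this is associativity once the two cut-offs agree,
  which is the formula for \<open>first\<close> of a composition.\<close>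

lemma act_comp:
  assumes "rigid s V" "rigid s W"
  shows "act (act w V) W = act w (V \<circ> W)"
proof (rule nth_equalityI)
  show "length (act (act w V) W) = length (act w (V \<circ> W))"
    by (simp add: rigid_comp(2)[OF assms])
  fix p assume "p < length (act (act w V) W)"
  then have p: "p < first W (first V (length w))"
    by simp
  then show "act (act w V) W ! p = act w (V \<circ> W) ! p"
    using less_first[OF assms(2) p] by (simp add: nth_act rigid_comp(2)[OF assms])
qed

lemma set_act:
  assumes "rigid s W"
  shows "set (act w W) = set w"
proof
  show "set (act w W) \<subseteq> set w"
  proof
    fix x assume "x \<in> set (act w W)"
    then obtain p where p: "p < first W (length w)" "x = w ! W p"
      by (auto simp: act_def)
    then show "x \<in> set w"
      using less_first[OF assms p(1)] by simp
  qed
  show "set w \<subseteq> set (act w W)"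
  proof
    fix x assume "x \<in> set w"
    then obtain j where j: "j < length w" "w ! j = x"
      by (auto simp: in_set_conv_nth)
    then have "first W j < first W (length w)"
      using first_strict_mono[OF assms] by (simp add: strict_mono_less)
    then have "act w W ! first W j = x"
      using j at_first[OF assms, of j] by (simp add: nth_act)
    with \<open>first W j < first W (length w)\<close> show "x \<in> set (act w W)"
      using nth_mem[of "first W j" "act w W"] by simp
  qed
qed

lemma act_words:
  assumes W: "rigid s W" and w: "w \<in> words s k"
  shows "act w W \<in> words s k"
  unfolding words_def
proof (intro CollectI conjI allI impI)
  have l: "s \<le> length w"
    by (rule wordsD(1)[OF w])
  then show sf: "s \<le> length (act w W)"
    using le_first_rigid[OF W] by simp
  show "act w W ! i = i" if "i < s" for i
    using that sf by (simp add: nth_act rigidD(2)[OF W] wordsD(2)[OF w])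
  show "set (act w W) = {..<s + k}"
    using set_act[OF W] wordsD(3)[OF w] by simp
  fix p m assume p: "p < length (act w W)" "m < act w W ! p"
  then have "W p < length w"
    by (intro less_first[OF W]) simp
  moreover have "m < w ! W p"
    using p by (simp add: nth_act)
  ultimately obtain q where q: "q < W p" "w ! q = m"
    using wordsD(4)[OF w] by blast
  then obtain r where "r < p" "W r = q"
    using rigidD(3)[OF W] by blast
  then show "\<exists>q<p. act w W ! q = m"
    using q p by (intro exI[of _ r]) (auto simp: nth_act)
qed

text \<open>The prefix \<open>[0..<s]\<close> already contains all letters, so restricted growth
  puts no constraint on a tail of letters.\<close>

lemma words_0_iff: "w \<in> words s 0 \<longleftrightarrow> (\<exists>u\<in>lists {..<s}. w = [0..<s] @ u)"
proof
  assume w: "w \<in> words s 0"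
  then have "take s w = [0..<s]"
    by (intro nth_equalityI) (simp_all add: wordsD(1,2)[OF w])
  then have "w = [0..<s] @ drop s w"
    by (metis append_take_drop_id)
  moreover have "drop s w \<in> lists {..<s}"
    using wordsD(3)[OF w] set_drop_subset[of s w] by auto
  ultimately show "\<exists>u\<in>lists {..<s}. w = [0..<s] @ u"
    by blast
next
  assume "\<exists>u\<in>lists {..<s}. w = [0..<s] @ u"
  then obtain u where u: "u \<in> lists {..<s}" "w = [0..<s] @ u"
    by auto
  have pre: "w ! i = i" if "i < s" for i
    using that by (simp add: u nth_append)
  have sub: "set w \<subseteq> {..<s}"
    using u by auto
  have "\<exists>q<p. w ! q = m" if "p < length w" "m < w ! p" for p m
  proof (rule exI[of _ m])
    have "w ! p < s"
      using sub that(1) by (meson lessThan_iff nth_mem subsetD)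
    then have "m < s"
      using that by simp
    moreover have "m < p"
      using pre[of p] that \<open>m < s\<close> by (cases "p < s") auto
    ultimately show "m < p \<and> w ! m = m"
      using pre by auto
  qed
  moreover have "set w = {..<s}" "s \<le> length w"
    using u by auto
  ultimately show "w \<in> words s 0"
    unfolding words_def using pre by simp
qed

text \<open>\<open>W\<close> is the limit of the chain: \<open>R n\<close> becomes its part before
  the first occurrence of the parameter \<open>s + n\<close>.\<close>

lemma rigid_of_prefix_chain:
  fixes R :: "nat \<Rightarrow> nat list"
  assumes R0: "\<exists>x\<in>lists {..<s}. R 0 = [0..<s] @ x"
    and RS: "\<And>n. \<exists>x\<in>lists {..<s + Suc n}. R (Suc n) = R n @ (s + n) # x"
  obtains W where "rigid s W" "\<And>n. first W (s + n) = length (R n)"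
    "\<And>n p. p < length (R n) \<Longrightarrow> W p = R n ! p"
proof -
  have len: "s + n \<le> length (R n)" for n
  proof (induction n)
    case 0
    then show ?case using R0 by auto
  next
    case (Suc n)
    then show ?case using RS[of n] by auto
  qed
  have setR: "set (R n) = {..<s + n}" for n
  proof (induction n)
    case 0
    then show ?case using R0 by auto
  next
    case (Suc n)
    then show ?case using RS[of n] by auto
  qed
  have pre: "R (m + k) ! p = R m ! p \<and> p < length (R (m + k))" if "p < length (R m)" for m k p
  proof (induction k)
    case 0
    then show ?case using that by auto
  next
    case (Suc k)
    then show ?case using RS[of "m + k"] by (auto simp: nth_append)
  qed
  \<comment> \<open>\<open>R (Suc p)\<close> has length at least \<open>s + Suc p\<close>, so
    position \<open>p\<close> exists there and no longer changes.\<close>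
  define W where "W p = R (Suc p) ! p" for p
  have W: "W p = R n ! p" if "p < length (R n)" for n p
  proof (cases "n \<le> Suc p")
    case True
    then show ?thesis
      using pre[OF that, of "Suc p - n"] by (simp add: W_def)
  next
    case False
    have "p < length (R (Suc p))"
      using len[of "Suc p"] by simp
    with False show ?thesis
      using pre[of p "Suc p" "n - Suc p"] by (simp add: W_def)
  qed
  have Wlen: "W (length (R n)) = s + n" for n
    using RS[of n] by (auto simp: W[of _ "Suc n"])
  have occ: "\<exists>q<length (R n). W q = m" if "m < s + n" for m n
  proof -
    have "m \<in> set (R n)"
      using that setR by auto
    then show ?thesis
      by (auto simp: in_set_conv_nth W)
  qed
  have W0: "W i = i" if "i < s" for i
    using that R0 len[of 0] W[of i 0] by (auto simp: nth_append)
  have below: "W q < s + n" if "q < length (R n)" for q n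
    using W[OF that] setR[of n] that nth_mem by fastforce
  have "rigid s W"
    unfolding rigid_def
  proof (intro conjI allI impI)
    show "surj W"
    proof (rule surjI)
      show "W (SOME q. W q = m) = m" for m
        using occ[of m "Suc m"] by (intro someI_ex[of "\<lambda>q. W q = m"]) auto
    qed
    show "W i = i" if "i < s" for i
      using W0 that by auto
    fix p m assume m: "m < W p"
    show "\<exists>q<p. W q = m"
    proof (cases "W p < s")
      case True
      have "m < p"
      proof (rule ccontr)
        assume "\<not> m < p"
        then have "p < s" using m True by simp
        then show False using W0[of p] m \<open>\<not> m < p\<close> by simp
      qed
      then show ?thesis
        using W0[of m] m True by auto
    next
      case False
      define n where "n = W p - s"
      have "W p = s + n"
        using False by (simp add: n_def)
      then have "length (R n) \<le> p"
        using below[of p n] by (cases "p < length (R n)") auto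
      moreover obtain q where "q < length (R n)" "W q = m"
        using occ[of m n] m \<open>W p = s + n\<close> by auto
      ultimately show ?thesis
        by (metis less_le_trans)
    qed
  qed
  moreover have "first W (s + n) = length (R n)" for n
  proof (rule firstI[of W, OF Wlen])
    show "W q \<noteq> s + n" if "q < length (R n)" for q
      using below[OF that] by simp
  qed
  ultimately show thesis
    by (rule that) (rule W)
qed

lemma finite_words_of_length: "finite {w \<in> words s k. length w = n}"
  by (rule finite_subset[OF _ finite_lists_length_eq[of "{..<s + k}" n]]) (auto dest!: wordsD(3))

lemma vsub_param: "v \<in> lists {..s} \<Longrightarrow> vsub s (s + n) v \<in> lists {..<s + Suc n}"
  by (force simp: vsub_def in_lists_conv_set)

text \<open>The Carlson-Simpson theorem. \<open>W\<close> is built block by block; at each stage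
  only the finitely many instances of the part built so far have to be extended inside
  \<open>B\<close> by a common left variable word.\<close>

lemma ramsey_words_0:
  fixes col :: "nat list \<Rightarrow> 'c"
  assumes s: "0 < s" and fin: "finite (col ` words s 0)"
  obtains W c where "rigid s W" "\<And>w. w \<in> words s 0 \<Longrightarrow> col (act w W) = c"
proof -
  define col' where "col' u = col ([0..<s] @ u)" for u
  have "col' ` lists {..<s} \<subseteq> col ` words s 0"
    unfolding col'_def using words_0_iff by blast
  then have fin': "finite (col' ` lists {..<s})"
    using fin finite_subset by blast
  obtain B c where B: "B \<noteq> {}" "B \<subseteq> {w \<in> lists {..<s}. col' w = c}"
    and ext: "\<And>F. finite F \<Longrightarrow> F \<subseteq> B \<Longrightarrow>
       \<exists>v \<in> lists {..s}. v \<noteq> [] \<and> hd v = s \<and> (\<forall>w\<in>F. \<forall>b<s. w @ vsub s b v \<in> B)"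
    by (rule carlson_simpson_step[OF s fin']) (rule that)
  \<comment> \<open>\<open>Q\<close> is the part of \<open>W\<close> before the parameter
    \<open>s + n\<close>, without the prefix \<open>[0..<s]\<close> that \<open>col'\<close> puts
    back.\<close>
  define P where "P n Q \<longleftrightarrow> Q \<in> lists {..<s + n} \<and>
     (\<forall>w\<in>words s 0. length w = s + n \<longrightarrow> map ((!) w) Q \<in> B)" for n Q
  define E where "E n Q Q' \<longleftrightarrow> (\<exists>x\<in>lists {..<s + Suc n}. Q' = Q @ (s + n) # x)" for n and Q Q' :: "nat list"
  have "\<exists>Q. \<forall>n. P n (Q n) \<and> E n (Q n) (Q (Suc n))"
  proof (rule dependent_nat_choice)
    obtain Q where Q: "Q \<in> B"
      using B by auto
    then have Qs: "Q \<in> lists {..<s}"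
      using B by auto
    have "map ((!) w) Q = Q" if "w \<in> words s 0" for w
      by (rule map_idI) (use Qs wordsD(2)[OF that] in auto)
    then show "\<exists>Q. P 0 Q"
      using Q Qs by (auto simp: P_def)
  next
    fix Q n assume Q: "P n Q"
    define F where "F = (\<lambda>w. map ((!) w) Q) ` {w \<in> words s 0. length w = s + n}"
    have "finite F"
      unfolding F_def by (intro finite_imageI finite_words_of_length)
    moreover have "F \<subseteq> B"
      using Q by (auto simp: F_def P_def)
    ultimately obtain v where v: "v \<in> lists {..s}" "v \<noteq> []" "hd v = s"
      and vF: "\<And>w b. w \<in> F \<Longrightarrow> b < s \<Longrightarrow> w @ vsub s b v \<in> B"
      using ext[of F] by blast
    \<comment> \<open>The variable \<open>s\<close> of \<open>v\<close> is renamed to the fresh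
      parameter \<open>s + n\<close>. As \<open>v\<close> begins with it, the parameter first occurs
      directly after \<open>Q\<close>.\<close>
    define Q' where "Q' = Q @ vsub s (s + n) v"
    obtain x where x: "v = s # x"
      using v by (cases v) auto
    have "E n Q Q'"
      unfolding E_def
    proof (rule bexI[of _ "vsub s (s + n) x"])
      show "vsub s (s + n) x \<in> lists {..<s + Suc n}"
        using vsub_param[OF v(1)] by (simp add: x vsub_def)
    qed (simp add: Q'_def x vsub_def)
    moreover have "P (Suc n) Q'"
      unfolding P_def
    proof (intro conjI ballI impI)
      show "Q' \<in> lists {..<s + Suc n}"
        using Q vsub_param[OF v(1)] by (auto simp: Q'_def P_def)
      fix w assume w: "w \<in> words s 0" "length w = s + Suc n"
      then obtain u where u: "u \<in> lists {..<s}" "w = [0..<s] @ u"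
        unfolding words_0_iff by blast
      define w0 where "w0 = take (s + n) w"
      have ws: "w ! i < s" if "i < length w" for i
        using wordsD(3)[OF w(1)] nth_mem[OF that] by auto
      have w0: "w0 \<in> words s 0" "length w0 = s + n"
      proof -
        have "w0 = [0..<s] @ take n u" "take n u \<in> lists {..<s}"
          using u by (auto simp: w0_def dest: in_set_takeD)
        then show "w0 \<in> words s 0"
          using words_0_iff by blast
        show "length w0 = s + n"
          using w by (simp add: w0_def)
      qed
      have "map ((!) w) Q = map ((!) w0) Q"
        using Q w by (auto simp: w0_def P_def)
      \<comment> \<open>\<open>w\<close> fixes the letters below \<open>s\<close>, so only the new
        parameter is replaced, by the last letter of \<open>w\<close>.\<close>
      moreover have "map ((!) w) (vsub s (s + n) v) = vsub s (w ! (s + n)) v"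
        unfolding vsub_def map_map o_def using v(1) by (intro map_cong refl) (auto simp: wordsD(2)[OF w(1)])
      moreover have "map ((!) w0) Q @ vsub s (w ! (s + n)) v \<in> B"
        using w w0 ws by (intro vF) (auto simp: F_def)
      ultimately show "map ((!) w) Q' \<in> B"
        unfolding Q'_def map_append by metis
    qed
    ultimately show "\<exists>y. P (Suc n) y \<and> E n Q y"
      by blast
  qed
  then obtain Q where Q: "\<And>n. P n (Q n)" "\<And>n. E n (Q n) (Q (Suc n))"
    by blast
  define R where "R n = [0..<s] @ Q n" for n
  have R0: "\<exists>x\<in>lists {..<s}. R 0 = [0..<s] @ x"
    using Q(1)[of 0] by (auto simp: R_def P_def)
  have RS: "\<exists>x\<in>lists {..<s + Suc n}. R (Suc n) = R n @ (s + n) # x" for n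
    using Q(2)[of n] by (auto simp: R_def E_def)
  obtain W where W: "rigid s W" "\<And>n. first W (s + n) = length (R n)"
    "\<And>n p. p < length (R n) \<Longrightarrow> W p = R n ! p"
    by (rule rigid_of_prefix_chain[of s R, OF R0 RS]) (rule that)
  show thesis
  proof (rule that[OF W(1)])
    fix w assume w: "w \<in> words s 0"
    define n where "n = length w - s"
    have n: "length w = s + n"
      using wordsD(1)[OF w] by (simp add: n_def)
    have "act w W = map ((!) w) (R n)"
      by (rule nth_equalityI) (auto simp: n W(2,3) nth_act)
    also have "\<dots> = [0..<s] @ map ((!) w) (Q n)"
      using wordsD(2)[OF w] by (auto simp: R_def intro!: map_idI)
    finally have "act w W = [0..<s] @ map ((!) w) (Q n)" .
    moreover have "map ((!) w) (Q n) \<in> B"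
      using Q(1)[of n] w n by (auto simp: P_def)
    ultimately show "col (act w W) = c"
      using B by (auto simp: col'_def)
  qed
qed

section \<open>Splitting a word at its first parameter\<close>

lemma words_iff:
  "w \<in> words s k \<longleftrightarrow> s \<le> length w \<and> (\<forall>i<s. w ! i = i) \<and> set w = {..<s + k} \<and>
     (\<forall>p<length w. {..<w ! p} \<subseteq> set (take p w))"
proof -
  have "(\<forall>m<w ! p. \<exists>q<p. w ! q = m) \<longleftrightarrow> {..<w ! p} \<subseteq> set (take p w)" if "p < length w" for p
  proof -
    have "set (take p w) = (!) w ` {..<p}"
      using nth_image[of p w] that by (simp add: atLeast0LessThan)
    then show ?thesis
      by (auto simp: image_iff subset_iff)
  qed
  then show ?thesis
    unfolding words_def mem_Collect_eq by (intro conj_cong refl all_cong1 imp_cong) auto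
qed

lemma restricted_growth_append:
  "(\<forall>p<length (x @ t). {..<(x @ t) ! p} \<subseteq> set (take p (x @ t))) \<longleftrightarrow>
     (\<forall>p<length x. {..<x ! p} \<subseteq> set (take p x)) \<and>
     (\<forall>p<length t. {..<t ! p} \<subseteq> set x \<union> set (take p t))"
  (is "?L \<longleftrightarrow> ?A \<and> ?B")
proof
  assume L: ?L
  have ?A
  proof (intro allI impI)
    show "{..<x ! p} \<subseteq> set (take p x)" if "p < length x" for p
      using L[rule_format, of p] that by (simp add: nth_append)
  qed
  moreover have ?B
  proof (intro allI impI)
    show "{..<t ! p} \<subseteq> set x \<union> set (take p t)" if "p < length t" for p
      using L[rule_format, of "length x + p"] that by simp
  qed
  ultimately show "?A \<and> ?B" ..
next
  assume AB: "?A \<and> ?B"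
  show ?L
  proof (intro allI impI)
    fix p assume p: "p < length (x @ t)"
    show "{..<(x @ t) ! p} \<subseteq> set (take p (x @ t))"
    proof (cases "p < length x")
      case True
      then show ?thesis using AB by (simp add: nth_append)
    next
      case False
      define q where "q = p - length x"
      have "p = length x + q" "q < length t"
        using False p by (auto simp: q_def)
      then show ?thesis using AB by simp
    qed
  qed
qed

lemma words_append_iff:
  assumes "set x = {..<n}" "s \<le> length x" "\<And>i. i < s \<Longrightarrow> x ! i = i"
    and "\<forall>p<length x. {..<x ! p} \<subseteq> set (take p x)"
  shows "x @ t \<in> words s k \<longleftrightarrow> {..<n} \<union> set t = {..<s + k} \<and>
    (\<forall>p<length t. {..<t ! p} \<subseteq> {..<n} \<union> set (take p t))"
proof -
  have "s \<le> length (x @ t)" "\<forall>i<s. (x @ t) ! i = i"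
    using assms(2,3) by (auto simp: nth_append)
  then show ?thesis
    unfolding words_iff restricted_growth_append set_append assms(1) using assms(4) by blast
qed

text \<open>Restricted growth of a tail depends only on the set of earlier values, which is the same
  for \<open>u @ [s]\<close> and \<open>[0..<Suc s]\<close>. This turns the first parameter into an
  additional letter behind a fixed \<open>u\<close>.\<close>

lemma word_tail_iff:
  assumes u: "u \<in> words s 0"
  shows "u @ s # t \<in> words s (Suc k) \<longleftrightarrow> [0..<Suc s] @ t \<in> words (Suc s) k"
proof -
  have U: "set u = {..<s}" "s \<le> length u" "\<forall>i<s. u ! i = i" "\<forall>p<length u. {..<u ! p} \<subseteq> set (take p u)"
    using u by (simp_all add: words_iff)
  have "\<forall>p<length [s]. {..<[s] ! p} \<subseteq> set u \<union> set (take p [s])"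
    using U(1) by simp
  then have 1: "\<forall>p<length (u @ [s]). {..<(u @ [s]) ! p} \<subseteq> set (take p (u @ [s]))"
    unfolding restricted_growth_append using U(4) by blast
  have 2: "\<forall>p<length [0..<Suc s]. {..<[0..<Suc s] ! p} \<subseteq> set (take p [0..<Suc s])"
    by (auto simp: take_upt simp del: upt_Suc)
  have 3: "set (u @ [s]) = {..<Suc s}" "set [0..<Suc s] = {..<Suc s}"
    by (simp_all add: U(1) lessThan_Suc atLeast0LessThan)
  have "(u @ [s]) @ t \<in> words s (Suc k) \<longleftrightarrow> {..<Suc s} \<union> set t = {..<s + Suc k} \<and>
      (\<forall>p<length t. {..<t ! p} \<subseteq> {..<Suc s} \<union> set (take p t))"
    using U(2,3) by (intro words_append_iff[OF 3(1) _ _ 1]) (simp_all add: nth_append)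
  moreover have "[0..<Suc s] @ t \<in> words (Suc s) k \<longleftrightarrow> {..<Suc s} \<union> set t = {..<Suc s + k} \<and>
      (\<forall>p<length t. {..<t ! p} \<subseteq> {..<Suc s} \<union> set (take p t))"
    by (intro words_append_iff[OF 3(2) _ _ 2]) (simp_all del: upt_Suc)
  ultimately show ?thesis
    by simp
qed

text \<open>The cut is at the first \<open>s\<close>: by restricted growth every larger number comes
  after it, so \<open>u\<close> consists of letters.\<close>

lemma split_word:
  assumes w: "w \<in> words s (Suc k)"
  obtains u t where "w = u @ s # t" "u \<in> words s 0"
proof -
  have "s \<in> set w"
    using wordsD(3)[OF w] by auto
  then obtain u t where ut: "w = u @ s # t" "s \<notin> set u"
    by (metis split_list_first)
  have pre: "\<forall>i<s. w ! i = i" and g: "\<forall>p<length w. {..<w ! p} \<subseteq> set (take p w)"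
    using w by (auto simp: words_iff)
  have len: "s \<le> length u"
    using pre ut by (metis less_irrefl not_le nth_append_length)
  have gu: "\<forall>p<length u. {..<u ! p} \<subseteq> set (take p u)"
    using g unfolding ut restricted_growth_append by blast
  have upre: "\<forall>i<s. u ! i = i"
    using pre len by (auto simp: ut nth_append)
  have "x < s" if "x \<in> set u" for x
  proof (rule ccontr)
    assume "\<not> x < s"
    obtain p where p: "p < length u" "u ! p = x"
      using \<open>x \<in> set u\<close> by (auto simp: in_set_conv_nth)
    have "x \<noteq> s"
      using that ut by auto
    then have "s \<in> set (take p u)"
      using gu p \<open>\<not> x < s\<close> by (auto simp: subset_iff)
    then show False
      using ut by (auto dest: in_set_takeD)
  qed
  moreover have "i \<in> set u" if "i < s" for i
    using upre len that nth_mem[of i u] by auto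
  ultimately have "set u = {..<s}"
    by auto
  then have "u \<in> words s 0"
    using len upre gu by (simp add: words_iff)
  with ut show thesis
    using that by blast
qed

section \<open>Fusion\<close>

text \<open>Colours are natural numbers here because the induction on \<open>k\<close> changes the set of colours.\<close>

definition homogeneous :: "nat \<Rightarrow> nat \<Rightarrow> bool" where
  "homogeneous s k \<longleftrightarrow> (\<forall>col :: nat list \<Rightarrow> nat. finite (col ` words s k) \<longrightarrow>
     (\<exists>W c. rigid s W \<and> (\<forall>w\<in>words s k. col (act w W) = c)))"

text \<open>Finitely many colours are coded injectively by numbers. Injectivity on the colours of
  \<open>words s k\<close> suffices to decode, since \<open>act\<close> stays inside this
  set.\<close>

lemma homogeneousE:
  fixes col :: "nat list \<Rightarrow> 'c"
  assumes "homogeneous s k" "finite (col ` words s k)"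
  obtains W c where "rigid s W" "\<And>w. w \<in> words s k \<Longrightarrow> col (act w W) = c"
proof -
  obtain f :: "'c \<Rightarrow> nat" where f: "inj_on f (col ` words s k)"
    using finite_imp_inj_to_nat_seg[OF assms(2)] by metis
  have "finite ((f \<circ> col) ` words s k)"
    unfolding image_comp[symmetric] by (rule finite_imageI[OF assms(2)])
  then obtain W c where W: "rigid s W" "\<forall>w\<in>words s k. (f \<circ> col) (act w W) = c"
    using assms(1) unfolding homogeneous_def by blast
  show thesis
  proof (cases "words s k = {}")
    case True
    then show thesis
      using that[OF W(1)] by blast
  next
    case False
    then obtain w0 where w0: "w0 \<in> words s k"
      by blast
    show thesis
    proof (rule that[OF W(1)])
      fix w assume w: "w \<in> words s k"
      have "f (col (act w W)) = f (col (act w0 W))"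
        using W(2) w w0 by simp
      then show "col (act w W) = col (act w0 W)"
        using f act_words[OF W(1)] w w0 by (meson imageI inj_onD)
    qed
  qed
qed

text \<open>
  \<open>V\<close> is \<open>V0\<close> with its prefix \<open>[0..<Suc s]\<close> stretched to \<open>[0..<Suc i]\<close>: the parameters after \<open>s\<close> are
  shifted, and the extra letter \<open>s\<close> of \<open>V0\<close> becomes the parameter \<open>i\<close>.
\<close>

lemma insert_parameters:
  assumes V0: "rigid (Suc s) V0" and i: "s \<le> i"
  obtains V where "rigid (Suc i) V"
    "\<And>u t. u \<in> words s 0 \<Longrightarrow> length u = i \<Longrightarrow>
       act (u @ s # t) V = u @ s # drop (Suc s) (act ([0..<Suc s] @ t) V0)"
proof -
  \<comment> \<open>\<open>h\<close> renames values: letters stay, the extra letter \<open>s\<close>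
    becomes \<open>i\<close>, and later values move by \<open>i - s\<close>. Positions move by the
    same amount, hence \<open>p - i + s\<close> in \<open>V\<close>.\<close>
  define h where "h v = (if v < s then v else v - s + i)" for v
  define V where "V p = (if p \<le> i then p else h (V0 (p - i + s)))" for p
  have V0_gt: "s < x" if "s < V0 x" for x
    using that rigidD(2)[OF V0, of x] by (cases "x < Suc s") auto
  have V_shift: "V (x - s + i) = V0 x - s + i" if "s < x" "s \<le> V0 x" for x
    using that by (simp add: V_def h_def)
  have "rigid (Suc i) V"
    unfolding rigid_def
  proof (intro conjI allI impI)
    have "\<exists>p. V p = n" for n
    proof (cases "n \<le> i")
      case True
      then show ?thesis by (auto simp: V_def)
    next
      case False
      define x where "x = first V0 (n - i + s)"
      have x: "V0 x = n - i + s"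
        unfolding x_def by (rule at_first[OF V0])
      then have "V (x - s + i) = n"
        using V_shift[of x] V0_gt[of x] False by simp
      then show ?thesis ..
    qed
    then show "surj V"
      unfolding surj_def by metis
    show "V j = j" if "j < Suc i" for j
      using that by (simp add: V_def)
    fix p m assume m: "m < V p"
    show "\<exists>q<p. V q = m"
    proof (cases "m \<le> i")
      case True
      then have "m < p"
        using m by (cases "p \<le> i") (auto simp: V_def)
      then show ?thesis
        using True by (auto simp: V_def)
    next
      case False
      then have p: "i < p"
        using m by (cases "p \<le> i") (auto simp: V_def)
      define v where "v = V0 (p - i + s)"
      have "V p = h v"
        using p by (simp add: V_def v_def)
      then have "m - i + s < v"
        using m False i by (auto simp: h_def split: if_splits)
      then obtain x where x: "x < p - i + s" "V0 x = m - i + s"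
        using rigidD(3)[OF V0, of "m - i + s" "p - i + s"] unfolding v_def by blast
      then have "s < x"
        using V0_gt[of x] False by simp
      then have "V (x - s + i) = m" "x - s + i < p"
        using V_shift[of x] x False p by auto
      then show ?thesis
        by blast
    qed
  qed
  note V = this
  \<comment> \<open>First occurrences are shifted like all positions, so the cut-offs of the two
    substitutions correspond.\<close>
  have first_V: "first V (Suc i + r) = first V0 (Suc s + r) - s + i" for r
  proof (rule firstI)
    define x where "x = first V0 (Suc s + r)"
    have x: "V0 x = Suc s + r"
      unfolding x_def by (rule at_first[OF V0])
    have sx: "s < x"
      using V0_gt[of x] x by simp
    then show "V (first V0 (Suc s + r) - s + i) = Suc i + r"
      using V_shift[of x] x by (simp add: x_def)
    fix q assume q: "q < first V0 (Suc s + r) - s + i"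
    show "V q \<noteq> Suc i + r"
    proof (cases "q \<le> i")
      case True
      then show ?thesis by (simp add: V_def)
    next
      case False
      then have "q - i + s < first V0 (Suc s + r)"
        using q sx unfolding x_def by linarith
      then have "V0 (q - i + s) < Suc s + r"
        by (rule less_first[OF V0])
      then have "h (V0 (q - i + s)) < Suc i + r"
        using i unfolding h_def by (split if_split) linarith
      then show ?thesis
        using False by (simp add: V_def)
    qed
  qed
  show thesis
  proof (rule that[OF V])
    fix u t assume u: "u \<in> words s 0" "length u = i"
    define w where "w = u @ s # t"
    define w' where "w' = [0..<Suc s] @ t"
    have len: "length w = Suc i + length t" "length w' = Suc s + length t"
      using u by (simp_all add: w_def w'_def)
    have s_less: "s < first V0 (length w')"
      using le_first_rigid[OF V0, of "length w'"] len by simp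
    \<comment> \<open>Reading \<open>w\<close> at a renamed value is reading \<open>w'\<close> at
      the original one, so both substitutions agree beyond the stretched prefix.\<close>
    have nth: "w ! h v = w' ! v" if "v < length w'" for v
    proof -
      consider "v < s" | "v = s" | "s < v"
        by linarith
      then show ?thesis
      proof cases
        case 1
        then show ?thesis
          using wordsD(2)[OF u(1)] u(2) i by (simp add: h_def w_def w'_def nth_append del: upt_Suc)
      next
        case 2
        then show ?thesis
          using u(2) by (simp add: h_def w_def w'_def nth_append del: upt_Suc)
      next
        case 3
        then obtain r where r: "v = Suc (s + r)"
          using less_imp_Suc_add by blast
        have "h v = length u + Suc r"
          using u(2) r by (simp add: h_def)
        then have "w ! h v = t ! r"
          unfolding w_def by (simp only: nth_append_length_plus nth_Cons_Suc)
        also have "\<dots> = w' ! v"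
          using nth_append_length_plus[of "[0..<Suc s]" t r] by (simp add: r w'_def del: upt_Suc)
        finally show ?thesis .
      qed
    qed
    have "act w V = u @ s # drop (Suc s) (act w' V0)"
    proof (rule nth_equalityI)
      show "length (act w V) = length (u @ s # drop (Suc s) (act w' V0))"
        using s_less u(2) by (simp add: len first_V[simplified])
      fix p assume p: "p < length (act w V)"
      show "act w V ! p = (u @ s # drop (Suc s) (act w' V0)) ! p"
      proof (cases "p \<le> i")
        case True
        then have "act w V ! p = w ! p"
          using p by (simp add: nth_act V_def)
        also have "\<dots> = (u @ s # drop (Suc s) (act w' V0)) ! p"
          using True u(2) by (cases "p = i") (simp_all add: w_def nth_append)
        finally show ?thesis .
      next
        case False
        then have q: "p - i + s < first V0 (length w')"
          using p s_less by (simp add: len first_V[simplified])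
        have "act w V ! p = w ! h (V0 (p - i + s))"
          using p False by (simp add: nth_act V_def)
        also have "\<dots> = w' ! V0 (p - i + s)"
          by (rule nth[OF less_first[OF V0 q]])
        also have "\<dots> = act w' V0 ! (p - i + s)"
          by (simp add: nth_act[OF q])
        also have "\<dots> = drop (Suc s) (act w' V0) ! (p - Suc i)"
        proof -
          have "p - i + s = Suc s + (p - Suc i)"
            using False by linarith
          moreover have "drop (Suc s) (act w' V0) ! (p - Suc i) = act w' V0 ! (Suc s + (p - Suc i))"
            using s_less by (intro nth_drop) simp
          ultimately show ?thesis
            by metis
        qed
        also have "\<dots> = (u @ s # drop (Suc s) (act w' V0)) ! p"
          using False u(2) by (simp add: nth_append nth_Cons')
        finally show ?thesis .
      qed
    qed
    then show "act (u @ s # t) V = u @ s # drop (Suc s) (act ([0..<Suc s] @ t) V0)"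
      by (simp add: w_def w'_def)
  qed
qed

text \<open>Only finitely many \<open>u\<close> have length \<open>i\<close>, so a single
  application of case \<open>k\<close>, over \<open>Suc s\<close> letters, handles the colours for
  all of them together. As \<open>V\<close> fixes everything up to \<open>i\<close>, what was
  achieved for shorter prefixes survives.\<close>

lemma fusion_step:
  fixes col :: "nat list \<Rightarrow> nat"
  assumes hom: "homogeneous (Suc s) k" and i: "s \<le> i" and W: "rigid s W"
    and fin: "finite (col ` words s (Suc k))"
  obtains V where "rigid (Suc i) V"
    "\<And>u. u \<in> words s 0 \<Longrightarrow> length u = i \<Longrightarrow>
       \<exists>c. \<forall>t. u @ s # t \<in> words s (Suc k) \<longrightarrow> col (act (u @ s # t) (V \<circ> W)) = c"
proof -
  define U where "U = {u \<in> words s 0. length u = i}"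
  \<comment> \<open>The prefix \<open>[0..<Suc s]\<close> of \<open>w\<close> is exchanged for
    \<open>u @ [s]\<close>; the letter \<open>s\<close> thereby turns back into the first
    parameter.\<close>
  define colv where "colv w = (\<lambda>u\<in>U. col (act (u @ s # drop (Suc s) w) W))" for w
  have tail: "w = [0..<Suc s] @ drop (Suc s) w" if "w \<in> words (Suc s) k" for w
  proof -
    have "take (Suc s) w = [0..<Suc s]"
      using wordsD(1,2)[OF that] by (intro nth_equalityI) (simp_all del: upt_Suc)
    then show ?thesis
      by (metis append_take_drop_id)
  qed
  have "colv w \<in> U \<rightarrow>\<^sub>E col ` words s (Suc k)" if w: "w \<in> words (Suc s) k" for w
  proof -
    have "u @ s # drop (Suc s) w \<in> words s (Suc k)" if "u \<in> U" for u
      using that w tail[OF w] by (simp add: U_def word_tail_iff del: upt_Suc)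
    then show ?thesis
      using act_words[OF W] by (auto simp: colv_def)
  qed
  then have "colv ` words (Suc s) k \<subseteq> U \<rightarrow>\<^sub>E col ` words s (Suc k)"
    by blast
  moreover have "finite (U \<rightarrow>\<^sub>E col ` words s (Suc k))"
    unfolding U_def by (intro finite_PiE finite_words_of_length fin)
  ultimately have "finite (colv ` words (Suc s) k)"
    by (rule finite_subset)
  then obtain V0 c where V0: "rigid (Suc s) V0" "\<And>w. w \<in> words (Suc s) k \<Longrightarrow> colv (act w V0) = c"
    using homogeneousE[OF hom] by metis
  obtain V where V: "rigid (Suc i) V"
    "\<And>u t. u \<in> words s 0 \<Longrightarrow> length u = i \<Longrightarrow>
       act (u @ s # t) V = u @ s # drop (Suc s) (act ([0..<Suc s] @ t) V0)"
    by (rule insert_parameters[OF V0(1) i]) (rule that)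
  have Vs: "rigid s V"
    using V(1) i by (auto intro: rigid_mono)
  show thesis
  proof (rule that[OF V(1)], rule exI, intro allI impI)
    fix u t assume u: "u \<in> words s 0" "length u = i" and t: "u @ s # t \<in> words s (Suc k)"
    have w': "[0..<Suc s] @ t \<in> words (Suc s) k"
      using t word_tail_iff[OF u(1)] by blast
    have "col (act (u @ s # t) (V \<circ> W)) = col (act (act (u @ s # t) V) W)"
      by (simp add: act_comp[OF Vs W])
    also have "\<dots> = colv (act ([0..<Suc s] @ t) V0) u"
      using u by (simp add: V(2) colv_def U_def del: upt_Suc)
    also have "\<dots> = c u"
      using V0(2)[OF w'] by simp
    finally show "col (act (u @ s # t) (V \<circ> W)) = c u" .
  qed
qed

text \<open>Later factors are the identity below \<open>s + n\<close>, so a value of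
  \<open>W n\<close> below \<open>s + n\<close> is final and the sequence converges pointwise.
  Prefixes of length \<open>s + n\<close> are settled by \<open>W (Suc n)\<close>.\<close>

lemma fusion:
  fixes col :: "nat list \<Rightarrow> nat"
  assumes hom: "homogeneous (Suc s) k" and fin: "finite (col ` words s (Suc k))"
  obtains W where "rigid s W"
    "\<And>u. u \<in> words s 0 \<Longrightarrow>
       \<exists>c. \<forall>t. u @ s # t \<in> words s (Suc k) \<longrightarrow> col (act (u @ s # t) W) = c"
proof -
  define Q where "Q n W W' \<longleftrightarrow> (\<exists>V. rigid (Suc (s + n)) V \<and> W' = V \<circ> W) \<and>
     (\<forall>u\<in>words s 0. length u = s + n \<longrightarrow>
       (\<exists>c. \<forall>t. u @ s # t \<in> words s (Suc k) \<longrightarrow> col (act (u @ s # t) W') = c))"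
    for n and W W' :: "nat \<Rightarrow> nat"
  have "\<exists>W. \<forall>n. rigid s (W n) \<and> Q n (W n) (W (Suc n))"
  proof (rule dependent_nat_choice)
    show "\<exists>W. rigid s W"
      using rigid_id by blast
    fix W n assume W: "rigid s W"
    obtain V where V: "rigid (Suc (s + n)) V"
      "\<And>u. u \<in> words s 0 \<Longrightarrow> length u = s + n \<Longrightarrow>
         \<exists>c. \<forall>t. u @ s # t \<in> words s (Suc k) \<longrightarrow> col (act (u @ s # t) (V \<circ> W)) = c"
      by (rule fusion_step[OF hom _ W fin, of "s + n"]) (simp, rule that)
    have "rigid s V"
      by (rule rigid_mono[OF V(1)]) simp
    then have "rigid s (V \<circ> W)"
      by (rule rigid_comp(1)[OF _ W])
    moreover have "Q n W (V \<circ> W)"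
      unfolding Q_def using V by blast
    ultimately show "\<exists>y. rigid s y \<and> Q n W y"
      by blast
  qed
  then obtain W where W: "\<And>n. rigid s (W n)" and Q: "\<And>n. Q n (W n) (W (Suc n))"
    by blast
  have factor: "\<exists>V. rigid (s + n) V \<and> W (n + j) = V \<circ> W n" for n j
  proof (induction j)
    case 0
    show ?case
      by (rule exI[of _ id], rule conjI[OF rigid_id]) simp
  next
    case (Suc j)
    then obtain V where V: "rigid (s + n) V" "W (n + j) = V \<circ> W n"
      by blast
    obtain V' where V': "rigid (Suc (s + (n + j))) V'" "W (Suc (n + j)) = V' \<circ> W (n + j)"
      using Q[of "n + j"] unfolding Q_def by blast
    have "rigid (s + n) V'"
      by (rule rigid_mono[OF V'(1)]) simp
    then have "rigid (s + n) (V' \<circ> V)"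
      by (rule rigid_comp(1)[OF _ V(1)])
    moreover have "W (n + Suc j) = (V' \<circ> V) \<circ> W n"
      using V(2) V'(2) by (simp add: comp_assoc)
    ultimately show ?case
      by blast
  qed
  have stable: "W (n + j) p = W n p" if "W n p < s + n" for n j p
  proof -
    obtain V where V: "rigid (s + n) V" "W (n + j) = V \<circ> W n"
      using factor[of n j] by blast
    then show ?thesis
      using rigidD(2)[OF V(1) that] by simp
  qed
  \<comment> \<open>Stage \<open>Suc p\<close> is late enough for position \<open>p\<close>, because
    a parameter word never exceeds its position: \<open>W (Suc p) p \<le> p\<close>.\<close>
  define L where "L p = W (Suc p) p" for p
  have L: "L p = W n p" if "W n p < s + n" for n p
  proof (cases "n \<le> Suc p")
    case True
    then show ?thesis
      using stable[OF that, of "Suc p - n"] by (simp add: L_def)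
  next
    case False
    have "W (Suc p) p < s + Suc p"
      using rigid_le[OF W, of "Suc p" p] by simp
    from stable[OF this, of "n - Suc p"] False show ?thesis
      by (simp add: L_def)
  qed
  have "rigid s L"
    unfolding rigid_def
  proof (intro conjI allI impI)
    have "\<exists>p. L p = n" for n
    proof
      have "W (Suc n) (first (W (Suc n)) n) = n"
        by (rule at_first[OF W])
      then show "L (first (W (Suc n)) n) = n"
        using L[of "Suc n" "first (W (Suc n)) n"] by simp
    qed
    then show "surj L"
      unfolding surj_def by metis
    show "L i = i" if "i < s" for i
      using rigidD(2)[OF W that] by (simp add: L_def)
    fix p m assume "m < L p"
    then have m: "m < W (Suc p) p"
      by (simp add: L_def)
    then obtain q where q: "q < p" "W (Suc p) q = m"
      using rigidD(3)[OF W] by blast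
    moreover have "m < s + Suc p"
      using m rigid_le[OF W, of "Suc p" p] by simp
    ultimately have "L q = m"
      using L[of "Suc p" q] by simp
    with q show "\<exists>q<p. L q = m"
      by blast
  qed
  \<comment> \<open>Substituting \<open>w\<close> involves only values up to
    \<open>length w\<close>, and these are final in \<open>W n\<close>.\<close>
  have act_L: "act w L = act w (W n)" if "length w < s + n" for w n
  proof -
    have "first L (length w) = first (W n) (length w)"
    proof (rule firstI)
      show "L (first (W n) (length w)) = length w"
        using L[of n "first (W n) (length w)"] that by (simp add: at_first[OF W])
      fix q assume "q < first (W n) (length w)"
      then have "W n q < length w"
        by (rule less_first[OF W])
      then show "L q \<noteq> length w"
        using L[of n q] that by simp
    qed
    moreover have "L p = W n p" if p: "p < first (W n) (length w)" for p
      using less_first[OF W p] L[of n p] \<open>length w < s + n\<close> by simp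
    ultimately show ?thesis
      by (simp add: act_def)
  qed
  show thesis
  proof (rule that[OF \<open>rigid s L\<close>])
    fix u assume u: "u \<in> words s 0"
    define n where "n = length u - s"
    have n: "length u = s + n"
      using wordsD(1)[OF u] by (simp add: n_def)
    obtain c where c: "\<And>t. u @ s # t \<in> words s (Suc k) \<Longrightarrow> col (act (u @ s # t) (W (Suc n))) = c"
      using Q[of n] u n unfolding Q_def by blast
    have "col (act (u @ s # t) L) = c" if t: "u @ s # t \<in> words s (Suc k)" for t
    proof -
      define w where "w = u @ s # t"
      define j where "j = length w"
      obtain V where V: "rigid (s + Suc n) V" "W (Suc n + j) = V \<circ> W (Suc n)"
        using factor[of "Suc n" j] by blast
      have Vs: "rigid s V"
        by (rule rigid_mono[OF V(1)]) simp
      have "act w L = act w (W (Suc n + j))"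
        by (rule act_L) (simp add: j_def)
      also have "\<dots> = act (act w V) (W (Suc n))"
        unfolding V(2) by (rule act_comp[OF Vs W, symmetric])
      finally have 1: "act w L = act (act w V) (W (Suc n))" .
      have wV: "act w V \<in> words s (Suc k)"
        using act_words[OF Vs] t by (simp add: w_def)
      have len: "s + Suc n \<le> first V (length w)"
        using le_first_rigid[OF V(1), of "length w"] n by (simp add: w_def)
      \<comment> \<open>\<open>V\<close> fixes all positions through the end of
        \<open>u @ [s]\<close>. So \<open>act w V\<close> is another word starting with
        \<open>u @ [s]\<close>, and the constant colour found for \<open>W (Suc n)\<close> applies
        to it.\<close>
      have "take (s + Suc n) (act w V) = u @ [s]"
      proof (rule nth_equalityI)
        show "length (take (s + Suc n) (act w V)) = length (u @ [s])"
          using len n by simp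
        fix p assume "p < length (take (s + Suc n) (act w V))"
        then have p: "p < s + Suc n"
          by simp
        then have "act w V ! p = w ! p"
          using len rigidD(2)[OF V(1) p] by (simp add: nth_act)
        also have "\<dots> = (u @ [s]) ! p"
          using p n by (cases "p = s + n") (simp_all add: w_def nth_append)
        finally show "take (s + Suc n) (act w V) ! p = (u @ [s]) ! p"
          using p by simp
      qed
      then have 2: "act w V = u @ s # drop (s + Suc n) (act w V)"
        by (metis append.assoc append_Cons append_Nil append_take_drop_id)
      then have "col (act (act w V) (W (Suc n))) = c"
        using c[of "drop (s + Suc n) (act w V)"] wV by simp
      then show ?thesis
        using 1 by (simp add: w_def)
    qed
    then show "\<exists>c. \<forall>t. u @ s # t \<in> words s (Suc k) \<longrightarrow> col (act (u @ s # t) L) = c"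
      by blast
  qed
qed

section \<open>The induction on the number of parameters\<close>

lemma homogeneous_0: "0 < s \<Longrightarrow> homogeneous s 0"
  unfolding homogeneous_def by (metis ramsey_words_0)

text \<open>After fusion the colour of \<open>u @ s # t\<close> is a function \<open>C\<close> of
  \<open>u\<close>, made constant by \<open>V\<close>. Substitution into \<open>V\<close> respects
  the split: the part before the first parameter becomes \<open>act u V\<close>.\<close>

lemma homogeneous_Suc:
  assumes s: "0 < s" and hom: "homogeneous (Suc s) k"
  shows "homogeneous s (Suc k)"
  unfolding homogeneous_def
proof (intro allI impI)
  fix col :: "nat list \<Rightarrow> nat"
  assume fin: "finite (col ` words s (Suc k))"
  obtain W where W: "rigid s W"
    "\<And>u. u \<in> words s 0 \<Longrightarrow>
       \<exists>c. \<forall>t. u @ s # t \<in> words s (Suc k) \<longrightarrow> col (act (u @ s # t) W) = c"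
    by (rule fusion[OF hom fin]) (rule that)
  define T where "T u = {t. u @ s # t \<in> words s (Suc k)}" for u
  \<comment> \<open>The colour \<open>0\<close> fills in for \<open>T u = {}\<close>, hence
    \<open>insert 0\<close> below.\<close>
  define C where "C u = (if T u = {} then 0 else col (act (u @ s # (SOME t. t \<in> T u)) W))" for u
  have some: "(SOME t. t \<in> T u) \<in> T u" if "T u \<noteq> {}" for u
    using that some_in_eq by blast
  have C: "col (act (u @ s # t) W) = C u" if u: "u \<in> words s 0" and t: "t \<in> T u" for u t
  proof -
    obtain c where c: "\<And>t. t \<in> T u \<Longrightarrow> col (act (u @ s # t) W) = c"
      using W(2)[OF u] unfolding T_def by blast
    have "T u \<noteq> {}"
      using t by blast
    then show ?thesis
      using c[OF t] c[OF some[of u]] by (simp add: C_def)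
  qed
  have "C u \<in> insert 0 (col ` words s (Suc k))" for u
  proof (cases "T u = {}")
    case True
    then show ?thesis by (simp add: C_def)
  next
    case False
    then have "u @ s # (SOME t. t \<in> T u) \<in> words s (Suc k)"
      using some[of u] by (simp add: T_def)
    then show ?thesis
      using act_words[OF W(1)] False by (simp add: C_def)
  qed
  then have "C ` words s 0 \<subseteq> insert 0 (col ` words s (Suc k))"
    by (rule image_subsetI)
  then have "finite (C ` words s 0)"
    using fin by (meson finite.insertI finite_subset)
  then obtain V c where V: "rigid s V" "\<And>u. u \<in> words s 0 \<Longrightarrow> C (act u V) = c"
    by (rule ramsey_words_0[OF s]) (rule that)
  have "col (act w (V \<circ> W)) = c" if w: "w \<in> words s (Suc k)" for w
  proof -
    obtain u t where ut: "w = u @ s # t" "u \<in> words s 0"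
      by (rule split_word[OF w]) (rule that)
    define t' where "t' = drop (Suc (first V (length u))) (act w V)"
    have lt: "first V (length u) < first V (length w)"
      using first_strict_mono[OF V(1)] by (simp add: ut strict_mono_less)
    have "take (Suc (first V (length u))) (act w V) = act u V @ [s]"
    proof (rule nth_equalityI)
      show "length (take (Suc (first V (length u))) (act w V)) = length (act u V @ [s])"
        using lt by simp
      fix p assume "p < length (take (Suc (first V (length u))) (act w V))"
      then have p: "p < Suc (first V (length u))"
        by simp
      then have "act w V ! p = w ! V p"
        using lt by (simp add: nth_act)
      also have "\<dots> = (act u V @ [s]) ! p"
      proof (cases "p = first V (length u)")
        case True
        then show ?thesis
          using at_first[OF V(1), of "length u"] by (simp add: ut nth_append)
      next
        case False
        then have p': "p < first V (length u)"
          using p by simp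
        then show ?thesis
          using less_first[OF V(1) p'] by (simp add: ut nth_append nth_act)
      qed
      finally show "take (Suc (first V (length u))) (act w V) ! p = (act u V @ [s]) ! p"
        using p by simp
    qed
    then have eq: "act w V = act u V @ s # t'"
      unfolding t'_def by (metis append.assoc append_Cons append_Nil append_take_drop_id)
    have "t' \<in> T (act u V)"
      using act_words[OF V(1) w] by (simp add: T_def eq)
    then have "col (act (act w V) W) = C (act u V)"
      unfolding eq by (rule C[OF act_words[OF V(1) ut(2)]])
    then show ?thesis
      using V(2)[OF ut(2)] by (simp add: act_comp[OF V(1) W(1)])
  qed
  then show "\<exists>W c. rigid s W \<and> (\<forall>w\<in>words s (Suc k). col (act w W) = c)"
    using rigid_comp(1)[OF V(1) W(1)] by blast
qed

theorem homogeneous_words: "0 < s \<Longrightarrow> homogeneous s k"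
proof (induction k arbitrary: s)
  case 0
  then show ?case by (rule homogeneous_0)
next
  case (Suc k)
  then show ?case by (simp add: homogeneous_Suc)
qed

section \<open>Envelopes of tuples of words\<close>

text \<open>Induction on \<open>K\<close>: a further substitution into \<open>V\<close> keeps the
  constancy already reached, as \<open>act w V\<close> has as many parameters as
  \<open>w\<close>.\<close>

lemma ramsey_words_simultaneous:
  fixes col :: "nat \<Rightarrow> nat list \<Rightarrow> 'c"
  assumes s: "0 < s" and fin: "\<And>k. k < K \<Longrightarrow> finite (col k ` words s k)"
  shows "\<exists>W c. rigid s W \<and> (\<forall>k<K. \<forall>w\<in>words s k. col k (act w W) = c k)"
  using fin
proof (induction K)
  case 0
  then show ?case
    using rigid_id by blast
next
  case (Suc K)
  then obtain W c where W: "rigid s W" "\<And>k w. k < K \<Longrightarrow> w \<in> words s k \<Longrightarrow> col k (act w W) = c k"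
    by (metis less_SucI)
  have "(\<lambda>w. col K (act w W)) ` words s K \<subseteq> col K ` words s K"
    using act_words[OF W(1)] by blast
  then have "finite ((\<lambda>w. col K (act w W)) ` words s K)"
    using Suc.prems[of K] finite_subset by blast
  then obtain V b where V: "rigid s V" "\<And>w. w \<in> words s K \<Longrightarrow> col K (act (act w V) W) = b"
    by (rule homogeneousE[OF homogeneous_words[OF s]]) (rule that)
  have "col k (act w (V \<circ> W)) = (c(K := b)) k" if "k < Suc K" "w \<in> words s k" for k w
  proof (cases "k = K")
    case True
    then show ?thesis
      using V(2) that by (simp add: act_comp[OF V(1) W(1), symmetric])
  next
    case False
    then show ?thesis
      using W(2)[of k "act w V"] act_words[OF V(1) that(2)] that
      by (simp add: act_comp[OF V(1) W(1), symmetric])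
  qed
  then show ?case
    using rigid_comp(1)[OF V(1) W(1)] by blast
qed

text \<open>A decoding is a map on the values together with an end marker; if the marker does not
  occur, all of \<open>U\<close> is read.\<close>

definition decode :: "(nat \<Rightarrow> nat) \<times> nat \<Rightarrow> nat list \<Rightarrow> nat list" where
  "decode \<delta> U = map (fst \<delta>) (takeWhile (\<lambda>x. x \<noteq> snd \<delta>) U)"

text \<open>If the decoded part of \<open>U\<close> has length \<open>l\<close>, then the first
  marker of \<open>act U W\<close>, if any, stands at \<open>first W l\<close>; renaming values
  commutes with \<open>act\<close>. So a whole tuple moves under \<open>W\<close> as its common
  envelope does.\<close>

lemma decode_act:
  assumes W: "rigid s W"
  shows "decode \<delta> (act U W) = act (decode \<delta> U) W"
proof -
  obtain g j where \<delta>: "\<delta> = (g, j)"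
    by (cases \<delta>)
  define T where "T = takeWhile (\<lambda>x. x \<noteq> j) U"
  define l where "l = length T"
  have T_nth: "T ! p = U ! p" if "p < l" for p
    using that by (simp add: T_def l_def takeWhile_nth)
  have lU: "l \<le> length U"
    by (simp add: l_def T_def length_takeWhile_le)
  then have fl: "first W l \<le> first W (length U)"
    using first_strict_mono[OF W] by (simp add: strict_mono_less_eq)
  have "takeWhile (\<lambda>x. x \<noteq> j) (act U W) = take (first W l) (act U W)"
  proof (rule takeWhile_eq_take_P_nth)
    fix p assume p: "p < first W l" "p < length (act U W)"
    have "W p < l"
      by (rule less_first[OF W p(1)])
    then have "U ! W p \<noteq> j"
      using T_nth[of "W p"] nth_mem[of "W p" T] set_takeWhileD[of "T ! W p" "\<lambda>x. x \<noteq> j" U]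
      by (simp add: l_def T_def)
    then show "act U W ! p \<noteq> j"
      using p by (simp add: nth_act)
  next
    assume *: "first W l < length (act U W)"
    then have "l < length U"
      using first_strict_mono[OF W] by (simp add: strict_mono_less)
    then have "U ! l = j"
      using nth_length_takeWhile[of "\<lambda>x. x \<noteq> j" U] by (simp add: l_def T_def)
    then show "\<not> act U W ! first W l \<noteq> j"
      using * at_first[OF W, of l] by (simp add: nth_act)
  qed
  then have "decode \<delta> (act U W) = map g (take (first W l) (act U W))"
    by (simp add: decode_def \<delta>)
  also have "\<dots> = act (map g T) W"
  proof (rule nth_equalityI)
    show "length (map g (take (first W l) (act U W))) = length (act (map g T) W)"
      using fl by (simp add: l_def)
    fix p assume "p < length (map g (take (first W l) (act U W)))"
    then have p: "p < first W l" "p < first W (length U)"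
      by simp_all
    show "map g (take (first W l) (act U W)) ! p = act (map g T) W ! p"
      using p less_first[OF W p(1)] T_nth[of "W p"] by (simp add: nth_act l_def)
  qed
  finally show ?thesis
    by (simp add: decode_def \<delta> T_def)
qed

lemma first_occurrence_ranking:
  fixes col :: "nat \<Rightarrow> 'b"
  obtains r :: "nat \<Rightarrow> nat" where "\<And>p q. r p = r q \<longleftrightarrow> col p = col q"
    "\<And>n. r ` {..<n} = {..<card (col ` {..<n})}"
proof -
  define fo where "fo p = (LEAST q. col q = col p)" for p
  have fo: "col (fo p) = col p" for p
    unfolding fo_def by (rule LeastI) (rule refl)
  have fo_le: "fo p \<le> q" if "col q = col p" for p q
    unfolding fo_def using that by (rule Least_le)
  have fo_eq: "fo p = fo q" if "col p = col q" for p q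
    using that by (simp add: fo_def)
  define r where "r p = card (col ` {..<fo p})" for p
  have less: "r p < r q" if "fo p < fo q" for p q
    unfolding r_def
  proof (rule psubset_card_mono)
    have "col (fo p) \<in> col ` {..<fo q}"
      using that by blast
    moreover have "col (fo p) \<notin> col ` {..<fo p}"
    proof
      assume "col (fo p) \<in> col ` {..<fo p}"
      then obtain x where "x < fo p" "col x = col p"
        using fo[of p] by auto
      then show False
        using fo_le[of x p] by simp
    qed
    moreover have "col ` {..<fo p} \<subseteq> col ` {..<fo q}"
      using that by (intro image_mono) auto
    ultimately show "col ` {..<fo p} \<subset> col ` {..<fo q}"
      by blast
  qed simp
  have iff: "r p = r q \<longleftrightarrow> col p = col q" for p q
  proof
    assume "r p = r q"
    then have "fo p = fo q"
      using less[of p q] less[of q p] by (cases "fo p" "fo q" rule: linorder_cases) auto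
    then show "col p = col q"
      using fo by metis
  next
    assume "col p = col q"
    then show "r p = r q"
      by (simp add: r_def fo_eq[of p q])
  qed
  have "r ` {..<n} = {..<card (col ` {..<n})}" for n
  proof (induction n)
    case 0
    show ?case by simp
  next
    case (Suc n)
    show ?case
    proof (cases "col n \<in> col ` {..<n}")
      case True
      then have "r n \<in> r ` {..<n}"
        using iff[of n] by auto
      then show ?thesis
        using True Suc by (simp add: lessThan_Suc insert_absorb)
    next
      case False
      have "fo n = n"
      proof (rule antisym)
        show "fo n \<le> n"
          by (rule fo_le) (rule refl)
        show "n \<le> fo n"
          using False fo[of n] by (metis imageI lessThan_iff not_le)
      qed
      then have "r n = card (col ` {..<n})"
        by (simp add: r_def)
      then show ?thesis
        using False Suc by (simp add: lessThan_Suc)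
    qed
  qed
  with iff show thesis
    by (rule that)
qed

text \<open>
  Write the words \<open>f a\<close> below each other, padded by \<open>s\<close>. Replacing each column by the rank of its
  first occurrence gives \<open>U\<close>; as there are at most \<open>(s + 1) ^ card A\<close> different columns, the
  number of parameters of \<open>U\<close> does not depend on \<open>f\<close>.
\<close>

lemma envelope:
  fixes f :: "'a \<Rightarrow> nat list"
  assumes A: "finite A" "A \<noteq> {}" and s: "0 < s" and f: "\<And>a. a \<in> A \<Longrightarrow> f a \<in> words s 0"
  obtains k U \<delta> where "k \<le> card (A \<rightarrow>\<^sub>E {..s})" "U \<in> words s k"
    "\<delta> \<in> A \<rightarrow>\<^sub>E ({..<s + k} \<rightarrow>\<^sub>E {..<s}) \<times> {..s + k}"
    "\<And>a. a \<in> A \<Longrightarrow> f a = decode (\<delta> a) U"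
proof -
  \<comment> \<open>The padding \<open>s\<close> is not a letter, so a column shows which words have
    ended.\<close>
  define col where "col p = (\<lambda>a\<in>A. if p < length (f a) then f a ! p else s)" for p
  obtain r :: "nat \<Rightarrow> nat" where r_eq: "\<And>p q. r p = r q \<longleftrightarrow> col p = col q"
    and r_im: "\<And>n. r ` {..<n} = {..<card (col ` {..<n})}"
    by (rule first_occurrence_ranking[of col]) (rule that)
  define L where "L = Max ((\<lambda>a. length (f a)) ` A)"
  have L: "length (f a) \<le> L" if "a \<in> A" for a
    unfolding L_def using A(1) that by (intro Max_ge) auto
  obtain a0 where a0: "a0 \<in> A"
    using A by auto
  have sL: "s \<le> L"
    using wordsD(1)[OF f[OF a0]] L[OF a0] by simp
  have f_less: "f a ! p < s" if "a \<in> A" "p < length (f a)" for a p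
    using wordsD(3)[OF f[OF that(1)]] nth_mem[OF that(2)] by auto
  define N where "N = card (col ` {..<L})"
  \<comment> \<open>Row \<open>a0\<close> begins with \<open>[0..<s]\<close> and tells the first
    \<open>s\<close> columns apart. Their ranks are therefore \<open>0, ..., s - 1\<close>, the
    prefix that \<open>U\<close> must have.\<close>
  have col_s: "col p a0 = p" if "p < s" for p
    using wordsD(1,2)[OF f[OF a0]] a0 that by (simp add: col_def)
  have inj: "inj_on col {..<s}"
    by (rule inj_onI) (metis col_s lessThan_iff)
  have card_s: "card (col ` {..<n}) = n" if "n \<le> s" for n
  proof -
    have "inj_on col {..<n}"
      using that by (intro inj_on_subset[OF inj]) auto
    then show ?thesis
      by (simp add: card_image)
  qed
  have r_s: "r n = n" if "n < s" for n
  proof -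
    have "r n \<in> r ` {..<Suc n}"
      by blast
    then have "r n \<le> n"
      using r_im[of "Suc n"] card_s[of "Suc n"] that by simp
    moreover have "r n \<notin> {..<n}"
    proof
      assume "r n \<in> {..<n}"
      then have "r n \<in> r ` {..<n}"
        using r_im[of n] card_s[of n] that by simp
      then obtain q where "q < n" "r n = r q"
        by auto
      then show False
        using r_eq[of n q] col_s[of n] col_s[of q] that by auto
    qed
    ultimately show ?thesis
      by simp
  qed
  have sN: "s \<le> N"
  proof -
    have "card (col ` {..<s}) \<le> N"
      unfolding N_def using sL by (intro card_mono image_mono) auto
    then show ?thesis
      using card_s[of s] by simp
  qed
  define k where "k = N - s"
  have Nk: "N = s + k"
    using sN by (simp add: k_def)
  have "col p \<in> A \<rightarrow>\<^sub>E {..s}" for p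
    using f_less by (auto simp: col_def less_imp_le)
  then have "N \<le> card (A \<rightarrow>\<^sub>E {..s})"
    unfolding N_def using A(1) by (intro card_mono finite_PiE) auto
  then have k_le: "k \<le> card (A \<rightarrow>\<^sub>E {..s})"
    by (simp add: k_def)
  define U where "U = map r [0..<L]"
  have r_less: "r p < N" if "p < L" for p
    using r_im[of L] that by (auto simp: N_def)
  have growth: "\<exists>q<p. r q = m" if "m < r p" for m p
  proof -
    have "r p \<in> r ` {..<Suc p}"
      by blast
    then have "r p < card (col ` {..<Suc p})"
      using r_im[of "Suc p"] by simp
    also have "\<dots> \<le> Suc (card (col ` {..<p}))"
      by (simp add: lessThan_Suc card_insert_if)
    finally have "m \<in> r ` {..<p}"
      using that r_im[of p] by simp
    then show ?thesis
      by auto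
  qed
  have U: "U \<in> words s k"
    unfolding words_def mem_Collect_eq
  proof (intro conjI allI impI)
    show "s \<le> length U"
      using sL by (simp add: U_def)
    show "U ! i = i" if "i < s" for i
      using that sL r_s[of i] by (simp add: U_def)
    show "set U = {..<s + k}"
      using r_im[of L] by (simp add: U_def N_def[symmetric] Nk atLeast0LessThan)
    fix p m assume p: "p < length U" "m < U ! p"
    then obtain q where "q < p" "r q = m"
      using growth[of m p] by (auto simp: U_def)
    then show "\<exists>q<p. U ! q = m"
      using p by (intro exI[of _ q]) (simp add: U_def)
  qed
  \<comment> \<open>Equal ranks mean equal columns, so any position \<open>p\<close> of that rank
    gives the same letter. Ranks that do not occur within \<open>f a\<close> get the letter
    \<open>0\<close>.\<close>
  define g where "g a = (\<lambda>x\<in>{..<s + k}. if \<exists>p<length (f a). r p = x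
      then f a ! (SOME p. p < length (f a) \<and> r p = x) else 0)" for a
  \<comment> \<open>The marker is the rank of the first column where row \<open>a\<close> is padded,
    or \<open>s + k\<close>, which does not occur in \<open>U\<close>, if \<open>f a\<close> has
    length \<open>L\<close>.\<close>
  define j where "j a = (if length (f a) < L then r (length (f a)) else s + k)" for a
  define \<delta> where "\<delta> = (\<lambda>a\<in>A. (g a, j a))"
  have col_nth: "f a ! p = f a ! q" if "a \<in> A" "p < length (f a)" "q < length (f a)" "r p = r q" for a p q
    using that r_eq[of p q] by (auto simp: col_def dest: fun_cong[of _ _ a])
  have g_r: "g a (r p) = f a ! p" if a: "a \<in> A" and p: "p < length (f a)" for a p
  proof -
    have ex: "\<exists>q<length (f a). r q = r p"
      using p by blast
    define q where "q = (SOME q. q < length (f a) \<and> r q = r p)"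
    have q: "q < length (f a)" "r q = r p"
      using someI_ex[OF ex] unfolding q_def by blast+
    have "r p < s + k"
      using r_less[of p] L[OF a] p Nk by simp
    then have "g a (r p) = f a ! q"
      using ex unfolding g_def q_def by simp
    then show ?thesis
      using col_nth[OF a q(1) p q(2)] by simp
  qed
  have g: "g a \<in> {..<s + k} \<rightarrow>\<^sub>E {..<s}" if a: "a \<in> A" for a
  proof (rule PiE_I)
    fix x assume x: "x \<in> {..<s + k}"
    show "g a x \<in> {..<s}"
    proof (cases "\<exists>p<length (f a). r p = x")
      case True
      then obtain p where "p < length (f a)" "r p = x"
        by blast
      then show ?thesis
        using g_r[OF a] f_less[OF a] by auto
    next
      case False
      then show ?thesis
        unfolding g_def restrict_apply if_not_P[OF False] using s x by simp
    qed
  qed (simp add: g_def)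
  have j: "j a \<le> s + k" for a
    using r_less[of "length (f a)"] Nk by (auto simp: j_def less_imp_le)
  show thesis
  proof (rule that[OF k_le U])
    show "\<delta> \<in> A \<rightarrow>\<^sub>E ({..<s + k} \<rightarrow>\<^sub>E {..<s}) \<times> {..s + k}"
      unfolding \<delta>_def using g j by (intro restrict_PiE_iff[THEN iffD2] ballI SigmaI) auto
    fix a assume a: "a \<in> A"
    have "takeWhile (\<lambda>x. x \<noteq> j a) U = take (length (f a)) U"
    proof (rule takeWhile_eq_take_P_nth)
      fix i assume i: "i < length (f a)" "i < length U"
      have "r i \<noteq> j a"
      proof (cases "length (f a) < L")
        case True
        have "col i a \<noteq> col (length (f a)) a"
          using a i f_less[OF a i(1)] by (simp add: col_def)
        then show ?thesis
          using True r_eq[of i "length (f a)"] by (auto simp: j_def)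
      next
        case False
        then show ?thesis
          using r_less[of i] i Nk by (simp add: j_def U_def)
      qed
      then show "U ! i \<noteq> j a"
        using i by (simp add: U_def)
    next
      assume "length (f a) < length U"
      then show "\<not> U ! length (f a) \<noteq> j a"
        by (simp add: U_def j_def)
    qed
    then have "decode (\<delta> a) U = map (g a) (take (length (f a)) U)"
      using a by (simp add: decode_def \<delta>_def)
    also have "\<dots> = f a"
      using g_r[OF a] L[OF a] by (intro nth_equalityI) (simp_all add: U_def)
    finally show "f a = decode (\<delta> a) U"
      by simp
  qed
qed

text \<open>A \<open>k\<close>-parameter word is coloured by the function sending each decoding to
  the colour of the decoded tuple. Once this is constant for every \<open>k < K\<close>, a tuple's
  colour depends only on its pair \<open>(k, \<delta>)\<close>, and the set \<open>I\<close> of such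
  pairs is independent of the colouring.\<close>

lemma finite_big_Ramsey_degree_tuples:
  fixes A :: "'a set"
  assumes A: "finite A" "A \<noteq> {}" and s: "0 < s"
  obtains t :: nat where "t > 0"
    "\<And>c :: ('a \<Rightarrow> nat list) \<Rightarrow> nat. finite (range c) \<Longrightarrow>
       \<exists>W. rigid s W \<and> card ((\<lambda>f. c (\<lambda>a\<in>A. act (f a) W)) ` (A \<rightarrow>\<^sub>E words s 0)) \<le> t"
proof -
  define K where "K = Suc (card (A \<rightarrow>\<^sub>E {..s}))"
  define \<Delta> where "\<Delta> k = A \<rightarrow>\<^sub>E ({..<s + k} \<rightarrow>\<^sub>E {..<s}) \<times> {..s + k}" for k
  have fin\<Delta>: "finite (\<Delta> k)" for k
    unfolding \<Delta>_def using A(1) by (intro finite_PiE finite_cartesian_product) auto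
  define I where "I = Sigma {..<K} \<Delta>"
  have finI: "finite I"
    unfolding I_def using fin\<Delta> by blast
  show thesis
  proof (rule that[of "Suc (card I)"])
    fix c :: "('a \<Rightarrow> nat list) \<Rightarrow> nat"
    assume c: "finite (range c)"
    define col where "col k U = (\<lambda>\<delta>\<in>\<Delta> k. c (\<lambda>a\<in>A. decode (\<delta> a) U))" for k U
    have "finite (col k ` words s k)" for k
    proof (rule finite_subset)
      show "col k ` words s k \<subseteq> \<Delta> k \<rightarrow>\<^sub>E range c"
        by (auto simp: col_def)
      show "finite (\<Delta> k \<rightarrow>\<^sub>E range c)"
        using fin\<Delta> c by (intro finite_PiE) auto
    qed
    then obtain W C where W: "rigid s W" and C: "\<And>k U. k < K \<Longrightarrow> U \<in> words s k \<Longrightarrow> col k (act U W) = C k"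
      using ramsey_words_simultaneous[OF s, of K col] by blast
    have "(\<lambda>f. c (\<lambda>a\<in>A. act (f a) W)) ` (A \<rightarrow>\<^sub>E words s 0) \<subseteq> (\<lambda>(k, \<delta>). C k \<delta>) ` I"
    proof (rule image_subsetI)
      fix f assume "f \<in> A \<rightarrow>\<^sub>E words s 0"
      then have f: "f a \<in> words s 0" if "a \<in> A" for a
        using that by blast
      obtain k U \<delta> where k: "k \<le> card (A \<rightarrow>\<^sub>E {..s})" and U: "U \<in> words s k"
        and \<delta>: "\<delta> \<in> A \<rightarrow>\<^sub>E ({..<s + k} \<rightarrow>\<^sub>E {..<s}) \<times> {..s + k}"
        and dec: "\<And>a. a \<in> A \<Longrightarrow> f a = decode (\<delta> a) U"
        by (rule envelope[OF A s f]) (assumption, rule that)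
      have kK: "k < K"
        using k by (simp add: K_def)
      have \<delta>': "\<delta> \<in> \<Delta> k"
        using \<delta> by (simp add: \<Delta>_def)
      have "(\<lambda>a\<in>A. act (f a) W) = (\<lambda>a\<in>A. decode (\<delta> a) (act U W))"
        by (rule restrict_ext) (simp add: dec decode_act[OF W])
      then have "c (\<lambda>a\<in>A. act (f a) W) = col k (act U W) \<delta>"
        using \<delta>' by (simp add: col_def)
      also have "\<dots> = C k \<delta>"
        using C[OF kK U] by simp
      finally show "c (\<lambda>a\<in>A. act (f a) W) \<in> (\<lambda>(k, \<delta>). C k \<delta>) ` I"
        using kK \<delta>' unfolding I_def by force
    qed
    then have "card ((\<lambda>f. c (\<lambda>a\<in>A. act (f a) W)) ` (A \<rightarrow>\<^sub>E words s 0)) \<le> card I"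
      using finI by (meson card_image_le card_mono finite_imageI le_trans)
    then show "\<exists>W. rigid s W \<and> card ((\<lambda>f. c (\<lambda>a\<in>A. act (f a) W)) ` (A \<rightarrow>\<^sub>E words s 0)) \<le> Suc (card I)"
      using W le_SucI by blast
  qed simp
qed

section \<open>Spaces with one block of distances\<close>

text \<open>Distances in one block differ by at most \<open>nth_dist S 1\<close>, the least positive
  distance, and this is at most \<open>z\<close>.\<close>

lemma one_block_distances:
  assumes S: "compact_distance_set S" "nontrivial_blocks S = {B1}" "S = {0} \<union> B1"
  shows "finite S" "S - {0} \<noteq> {}" "\<And>x. x \<in> S - {0} \<Longrightarrow> 0 < x"
    "\<And>x y z. x \<in> S - {0} \<Longrightarrow> y \<in> S - {0} \<Longrightarrow> z \<in> S - {0} \<Longrightarrow> x \<le> y + z"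
proof -
  have fin: "finite S" and S0: "0 \<in> S" and nonneg: "\<And>x. x \<in> S \<Longrightarrow> 0 \<le> x"
    using S(1) by (auto simp: compact_distance_set_def distance_set_def)
  show "finite S"
    by (rule fin)
  show "\<And>x. x \<in> S - {0} \<Longrightarrow> 0 < x"
    using nonneg by fastforce
  have jump_mem: "x \<in> S" if "jump_number S x" for x
    using that fin nth_mem[of _ "sorted_list_of_set S"] by (auto simp: jump_number_def nth_dist_def)
  have "B1 \<in> nontrivial_blocks S"
    using S(2) by simp
  then obtain a b where ab: "B1 = S \<inter> {a<..b}" "consecutive_jumps S a b"
    by (auto simp: nontrivial_blocks_def)
  then have "a \<in> S" "b \<in> S" "a < b"
    using jump_mem by (auto simp: consecutive_jumps_def)
  then have "b \<in> B1" "0 \<notin> B1"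
    using ab nonneg[of a] by auto
  then have B1: "B1 = S - {0}"
    using S(3) by auto
  then show ne: "S - {0} \<noteq> {}"
    using \<open>b \<in> B1\<close> by auto
  fix x y z assume xyz: "x \<in> S - {0}" "y \<in> S - {0}" "z \<in> S - {0}"
  have "B1 \<in> blocks S"
    using S(2) by (simp add: blocks_def)
  then have "same_block S x y"
    unfolding same_block_def by (rule bexI[rotated]) (use xyz in \<open>simp add: B1\<close>)
  then have "\<bar>x - y\<bar> \<le> nth_dist S 1"
    using conjunct2[OF S(1)[unfolded compact_distance_set_def], rule_format, OF xyz(1,2)] by simp
  moreover have "nth_dist S 1 \<le> z"
  proof -
    have "Min S = 0"
      using fin S0 nonneg by (intro Min_eqI) auto
    then have "sorted_list_of_set S = 0 # sorted_list_of_set (S - {0})"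
      using sorted_list_of_set_nonempty[of S] fin S0 by auto
    then have "nth_dist S 1 = Min (S - {0})"
      using sorted_list_of_set_nonempty[of "S - {0}"] fin ne by (simp add: nth_dist_def)
    then show ?thesis
      using fin xyz by simp
  qed
  ultimately show "x \<le> y + z"
    by linarith
qed

text \<open>By \<open>tri\<close>, adding a point with distances \<open>r\<close> to
  \<open>F\<close> gives an \<open>S\<close>-metric space. Universality realises it somewhere in
  \<open>U\<close>, and ultrahomogeneity moves its copy of \<open>F\<close> onto
  \<open>F\<close>.\<close>

lemma one_point_extension:
  fixes d :: "'u \<Rightarrow> 'u \<Rightarrow> real"
  assumes tri: "\<And>x y z. x \<in> S - {0} \<Longrightarrow> y \<in> S - {0} \<Longrightarrow> z \<in> S - {0} \<Longrightarrow> x \<le> y + z"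
    and S: "0 \<in> S" "\<And>x. x \<in> S - {0} \<Longrightarrow> 0 < x"
    and U: "is_Fraisse_limit S U d"
    and F: "finite F" "F \<subseteq> U" and r: "\<And>y. y \<in> F \<Longrightarrow> r y \<in> S - {0}"
  obtains x where "x \<in> U" "\<And>y. y \<in> F \<Longrightarrow> d x y = r y"
proof -
  have met: "Metric_space U d" and dS: "\<And>x y. x \<in> U \<Longrightarrow> y \<in> U \<Longrightarrow> d x y \<in> S"
    and uh: "ultrahomogeneous U d"
    and univ: "\<And>(A :: nat set) dA. finite A \<Longrightarrow> S_metric_space S A dA \<Longrightarrow>
        \<exists>F. finite F \<and> F \<subseteq> U \<and> isometries A dA F d \<noteq> {}"
    using U by (auto simp: is_Fraisse_limit_def S_metric_space_def)
  interpret Metric_space U d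
    by (rule met)
  define n where "n = card F"
  obtain e where e: "bij_betw e {..<n} F"
    using ex_bij_betw_nat_finite[OF F(1)] by (auto simp: n_def atLeast0LessThan)
  have eF: "e i \<in> F" if "i < n" for i
    using e that by (auto simp: bij_betw_def)
  have eU: "e i \<in> U" if "i < n" for i
    using eF[OF that] F by auto
  have e_inj: "e i = e j \<longleftrightarrow> i = j" if "i < n" "j < n" for i j
    using e that by (auto simp: bij_betw_def inj_on_def)
  \<comment> \<open>The new point is \<open>n\<close>. The absolute values keep \<open>dA\<close>
    nonnegative outside the carrier too, as \<open>Metric_space\<close> demands; on the carrier they
    change nothing.\<close>
  define dA where "dA i j = (if i = j then 0 else if i = n then \<bar>r (e j)\<bar>
      else if j = n then \<bar>r (e i)\<bar> else d (e i) (e j))" for i j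
  have abs_r: "\<bar>r (e i)\<bar> = r (e i)" if "i < n" for i
    using S(2)[OF r[OF eF[OF that]]] by simp
  have dA_S: "dA i j \<in> S - {0}" if "i \<le> n" "j \<le> n" "i \<noteq> j" for i j
  proof -
    have "d (e i) (e j) \<in> S - {0}" if "i < n" "j < n"
      using that \<open>i \<noteq> j\<close> dS[OF eU eU] zero[OF eU eU] e_inj by auto
    moreover have "\<bar>r (e l)\<bar> \<in> S - {0}" if "l < n" for l
      using abs_r[OF that] r[OF eF[OF that]] by simp
    ultimately show ?thesis
      using that unfolding dA_def by (cases "i = n"; cases "j = n") simp_all
  qed
  have "S_metric_space S {..n} dA"
    unfolding S_metric_space_def
  proof
    show "Metric_space {..n} dA"
    proof
      show "0 \<le> dA x y" for x y
        by (simp add: dA_def)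
      show "dA x y = dA y x" for x y
        by (simp add: dA_def commute)
      show "dA x y = 0 \<longleftrightarrow> x = y" if "x \<in> {..n}" "y \<in> {..n}" for x y
        using dA_S[of x y] that by (cases "x = y") (auto simp: dA_def)
      fix x y z assume xyz: "x \<in> {..n}" "y \<in> {..n}" "z \<in> {..n}"
      have nn: "0 \<le> dA x y" for x y
        by (simp add: dA_def)
      show "dA x z \<le> dA x y + dA y z"
      proof (cases "x = z \<or> x = y \<or> y = z")
        case True
        then show ?thesis
          using nn[of x y] nn[of y z] by (auto simp: dA_def)
      next
        case False
        then show ?thesis
          using xyz by (intro tri dA_S) auto
      qed
    qed
    show "\<forall>x\<in>{..n}. \<forall>y\<in>{..n}. dA x y \<in> S"
    proof (intro ballI)
      show "dA x y \<in> S" if "x \<in> {..n}" "y \<in> {..n}" for x y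
        using dA_S[of x y] that S(1) by (cases "x = y") (auto simp: dA_def)
    qed
  qed
  then obtain F' h where F': "F' \<subseteq> U" and h: "h \<in> isometries {..n} dA F' d"
    using univ[of "{..n}" dA] by blast
  have hd: "d (h i) (h j) = dA i j" if "i \<le> n" "j \<le> n" for i j
    using h that by (auto simp: isometries_def isometric_embeddings_def)
  have hU: "h i \<in> U" if "i \<le> n" for i
    using h that F' by (auto simp: isometries_def isometric_embeddings_def)
  have h_inj: "inj_on h {..n}"
  proof (rule inj_onI)
    fix i j assume ij: "i \<in> {..n}" "j \<in> {..n}" "h i = h j"
    then have "dA i j = 0"
      using hd[of i j] hU[of j] by simp
    then show "i = j"
      using dA_S[of i j] ij by auto
  qed
  define G where "G = h ` {..<n}"
  define q where "q = (\<lambda>z\<in>G. e (inv_into {..n} h z))"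
  have q_h: "q (h i) = e i" if "i < n" for i
    using that h_inj by (simp add: q_def G_def)
  have "q \<in> isometries G d F d"
    unfolding isometries_def isometric_embeddings_def
  proof (intro CollectI conjI ballI)
    show "q \<in> G \<rightarrow>\<^sub>E F"
    proof (rule PiE_I)
      show "q x \<in> F" if "x \<in> G" for x
        using that q_h eF by (auto simp: G_def)
      show "q x = undefined" if "x \<notin> G" for x
        using that by (simp add: q_def)
    qed
    show "d (q x) (q y) = d x y" if xy: "x \<in> G" "y \<in> G" for x y
    proof -
      obtain i j where ij: "i < n" "x = h i" "j < n" "y = h j"
        using xy by (auto simp: G_def)
      have "d (q x) (q y) = d (e i) (e j)"
        using ij by (simp add: q_h)
      also have "\<dots> = dA i j"
        using ij eU by (simp add: dA_def)
      also have "\<dots> = d x y"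
        using ij hd[of i j] by simp
      finally show ?thesis .
    qed
    have "q ` G = e ` {..<n}"
      unfolding G_def image_image using q_h by (intro image_cong) auto
    then show "q ` G = F"
      using e by (simp add: bij_betw_def)
  qed
  moreover have "finite G \<and> G \<subseteq> U \<and> finite F \<and> F \<subseteq> U"
    using hU F by (auto simp: G_def)
  ultimately obtain g where g: "g \<in> isometries U d U d" "\<forall>x\<in>G. g x = q x"
    using uh[unfolded ultrahomogeneous_def, rule_format, of G F q] by blast
  have gd: "d (g x) (g y) = d x y" "g x \<in> U" if "x \<in> U" "y \<in> U" for x y
    using g(1) that by (auto simp: isometries_def isometric_embeddings_def)
  show thesis
  proof (rule that[of "g (h n)"])
    show "g (h n) \<in> U"
      using gd(2) hU by blast
    fix y assume "y \<in> F"
    then obtain i where i: "i < n" "y = e i"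
      using e by (auto simp: bij_betw_def)
    then have "y = g (h i)"
      using g(2) q_h by (simp add: G_def)
    then have "d (g (h n)) y = dA n i"
      using gd(1)[of "h n" "h i"] hU hd[of n i] i(1) by simp
    also have "\<dots> = r y"
      using i abs_r[of i] by (simp add: dA_def)
    finally show "d (g (h n)) y = r y" .
  qed
qed

text \<open>The points are chosen one after another by \<open>one_point_extension\<close>, each with
  prescribed distances to the finitely many earlier ones.\<close>

lemma embed_sequence:
  fixes d :: "'u \<Rightarrow> 'u \<Rightarrow> real" and D :: "nat \<Rightarrow> nat \<Rightarrow> real"
  assumes tri: "\<And>x y z. x \<in> S - {0} \<Longrightarrow> y \<in> S - {0} \<Longrightarrow> z \<in> S - {0} \<Longrightarrow> x \<le> y + z"
    and S: "0 \<in> S" "\<And>x. x \<in> S - {0} \<Longrightarrow> 0 < x"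
    and U: "is_Fraisse_limit S U d"
    and D: "\<And>i. D i i = 0" "\<And>i j. D i j = D j i" "\<And>i j. i \<noteq> j \<Longrightarrow> D i j \<in> S - {0}"
  obtains \<phi> where "\<And>i. \<phi> i \<in> U" "\<And>i j. d (\<phi> i) (\<phi> j) = D i j"
proof -
  interpret Metric_space U d
    using U by (simp add: is_Fraisse_limit_def S_metric_space_def)
  define P where "P n ys \<longleftrightarrow> length ys = n \<and> set ys \<subseteq> U \<and> (\<forall>i<n. \<forall>j<n. d (ys ! i) (ys ! j) = D i j)" for n ys
  have "\<exists>f. \<forall>n. P n (f n) \<and> (\<exists>y. f (Suc n) = f n @ [y])"
  proof (rule dependent_nat_choice)
    show "\<exists>ys. P 0 ys"
      by (simp add: P_def)
    fix ys n assume ys: "P n ys"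
    have inj: "i = j" if "i < n" "j < n" "ys ! i = ys ! j" for i j
    proof (rule ccontr)
      assume "i \<noteq> j"
      have "ys ! j \<in> U"
        using ys that by (auto simp: P_def)
      then have "d (ys ! i) (ys ! j) = 0"
        using that by simp
      moreover have "d (ys ! i) (ys ! j) = D i j"
        using ys that unfolding P_def by blast
      ultimately show False
        using D(3)[OF \<open>i \<noteq> j\<close>] by simp
    qed
    define r where "r y = D n (THE i. i < n \<and> ys ! i = y)" for y
    have r: "r (ys ! i) = D n i" if "i < n" for i
    proof -
      have "(THE j. j < n \<and> ys ! j = ys ! i) = i"
        using that inj by (intro the_equality) auto
      then show ?thesis
        by (simp add: r_def)
    qed
    obtain y where y: "y \<in> U" "\<And>z. z \<in> set ys \<Longrightarrow> d y z = r z"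
    proof (rule one_point_extension[OF tri S U, of "set ys" r])
      show "r z \<in> S - {0}" if z: "z \<in> set ys" for z
      proof -
        obtain i where "i < n" "z = ys ! i"
          using z ys by (auto simp: P_def in_set_conv_nth)
        then show ?thesis
          using r D(3)[of n i] by simp
      qed
    qed (use ys in \<open>auto simp: P_def\<close>)
    have ny: "d y (ys ! i) = D n i" if "i < n" for i
      using y(2)[of "ys ! i"] r[OF that] ys that by (simp add: P_def)
    have "P (Suc n) (ys @ [y])"
      unfolding P_def
    proof (intro conjI allI impI)
      show "length (ys @ [y]) = Suc n" "set (ys @ [y]) \<subseteq> U"
        using ys y by (auto simp: P_def)
      fix i j assume "i < Suc n" "j < Suc n"
      then consider "i < n" "j < n" | "i = n" "j < n" | "i < n" "j = n" | "i = n" "j = n"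
        by linarith
      then show "d ((ys @ [y]) ! i) ((ys @ [y]) ! j) = D i j"
      proof cases
        case 1
        then show ?thesis
          using ys by (simp add: P_def nth_append)
      next
        case 2
        then show ?thesis
          using ys ny[of j] by (simp add: P_def nth_append)
      next
        case 3
        then show ?thesis
          using ys ny[of i] commute[of y "ys ! i"] D(2)[of n i] by (simp add: P_def nth_append)
      next
        case 4
        then show ?thesis
          using ys y(1) D(1)[of n] by (simp add: P_def nth_append)
      qed
    qed
    then show "\<exists>y. P (Suc n) y \<and> (\<exists>ya. y = ys @ [ya])"
      by blast
  qed
  then obtain f where P: "\<And>n. P n (f n)" and f: "\<And>n. \<exists>y. f (Suc n) = f n @ [y]"
    by blast
  have len: "length (f n) = n" for n
    using P[of n] by (simp add: P_def)
  have stable: "f (n + k) ! i = f n ! i" if "i < n" for n k i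
  proof (induction k)
    case (Suc k)
    then show ?case
      using f[of "n + k"] that len[of "n + k"] by (auto simp: nth_append)
  qed simp
  have nth: "f (Suc i) ! i = f n ! i" if "i < n" for i n
    using stable[of i "Suc i" "n - Suc i"] that by simp
  show thesis
  proof (rule that[of "\<lambda>i. f (Suc i) ! i"])
    show "f (Suc i) ! i \<in> U" for i
      using P[of "Suc i"] by (auto simp: P_def)
    show "d (f (Suc i) ! i) (f (Suc j) ! j) = D i j" for i j
      using P[of "Suc (max i j)"] nth[of i "Suc (max i j)"] nth[of j "Suc (max i j)"]
      by (simp add: P_def less_Suc_eq_le)
  qed
qed

section \<open>The metric on words\<close>

text \<open>
  Words of the same length may be given any fixed distance, since substitution into an infinite
  parameter word does not change whether two words have the same length.
\<close>

definition word_dist :: "(nat \<Rightarrow> real) \<Rightarrow> nat list \<Rightarrow> nat list \<Rightarrow> real" where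
  "word_dist D u v = (if u = v then 0 else if length u < length v then D (v ! length u)
     else if length v < length u then D (u ! length v) else D 0)"

lemma act_eq_iff:
  assumes W: "rigid s W"
  shows "act u W = act v W \<longleftrightarrow> u = v"
proof
  assume eq: "act u W = act v W"
  then have "first W (length u) = first W (length v)"
    by (metis length_act)
  then have len: "length u = length v"
    using first_strict_mono[OF W] by (simp add: strict_mono_eq)
  show "u = v"
  proof (rule nth_equalityI[OF len])
    fix j assume j: "j < length u"
    then have "first W j < first W (length u)"
      using first_strict_mono[OF W] by (simp add: strict_mono_less)
    then have "act u W ! first W j = u ! j" "act v W ! first W j = v ! j"
      using len at_first[OF W, of j] by (simp_all add: nth_act)
    then show "u ! j = v ! j"
      using eq by simp
  qed
qed simp

text \<open>The letter of the longer word at position \<open>length u\<close> reappears after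
  substitution at \<open>first W (length u)\<close>, which is the length of
  \<open>act u W\<close>.\<close>

lemma word_dist_act:
  assumes W: "rigid s W"
  shows "word_dist D (act u W) (act v W) = word_dist D u v"
proof -
  have less: "first W (length x) < first W (length y) \<longleftrightarrow> length x < length y" for x y :: "nat list"
    using first_strict_mono[OF W] by (simp add: strict_mono_less)
  have nth: "act y W ! first W (length x) = y ! length x" if "length x < length y" for x y :: "nat list"
    using that less[of x y] at_first[OF W] by (simp add: nth_act)
  show ?thesis
    unfolding word_dist_def act_eq_iff[OF W] length_act less by (simp add: nth)
qed

lemma infinite_words_0:
  assumes "0 < s"
  shows "infinite (words s 0)"
proof
  assume "finite (words s 0)"
  moreover have "range (\<lambda>n. [0..<s] @ replicate n 0) \<subseteq> words s 0"
    using assms by (auto simp: words_0_iff intro!: bexI[of _ "replicate _ 0"])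
  ultimately have "finite (range (\<lambda>n. [0..<s] @ replicate n (0 :: nat)))"
    by (rule finite_subset[rotated])
  moreover have "inj (\<lambda>n. [0..<s] @ replicate n (0 :: nat))"
    by (rule injI) (metis append_eq_append_conv length_replicate)
  ultimately show False
    using finite_imageD infinite_UNIV_nat by blast
qed

lemma words_embed:
  fixes d :: "'u \<Rightarrow> 'u \<Rightarrow> real"
  assumes tri: "\<And>x y z. x \<in> S - {0} \<Longrightarrow> y \<in> S - {0} \<Longrightarrow> z \<in> S - {0} \<Longrightarrow> x \<le> y + z"
    and S: "0 \<in> S" "\<And>x. x \<in> S - {0} \<Longrightarrow> 0 < x"
    and U: "is_Fraisse_limit S U d"
    and s: "0 < s" and D: "\<And>i. i < s \<Longrightarrow> D i \<in> S - {0}"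
  obtains \<phi> where "\<And>w. \<phi> w \<in> U"
    "\<And>u v. u \<in> words s 0 \<Longrightarrow> v \<in> words s 0 \<Longrightarrow> d (\<phi> u) (\<phi> v) = word_dist D u v"
proof -
  obtain e :: "nat list \<Rightarrow> nat" where e: "bij_betw e (words s 0) UNIV"
    using countableE_infinite[OF _ infinite_words_0[OF s]] by blast
  define x where "x = inv_into (words s 0) e"
  have x: "bij_betw x UNIV (words s 0)"
    unfolding x_def by (rule bij_betw_inv_into[OF e])
  have xw: "x i \<in> words s 0" for i
    using x by (auto simp: bij_betw_def)
  have xe: "x (e w) = w" if "w \<in> words s 0" for w
    unfolding x_def by (rule bij_betw_inv_into_left[OF e that])
  have xne: "x i \<noteq> x j" if "i \<noteq> j" for i j
    using x that by (auto simp: bij_betw_def dest: injD)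
  have letter: "w ! p < s" if "w \<in> words s 0" "p < length w" for w p
    using wordsD(3)[OF that(1)] nth_mem[OF that(2)] by auto
  obtain \<phi> where \<phi>: "\<And>i. \<phi> i \<in> U" "\<And>i j. d (\<phi> i) (\<phi> j) = word_dist D (x i) (x j)"
  proof (rule embed_sequence[OF tri S U, of "\<lambda>i j. word_dist D (x i) (x j)"])
    show "word_dist D (x i) (x i) = 0" for i
      by (simp add: word_dist_def)
    show "word_dist D (x i) (x j) = word_dist D (x j) (x i)" for i j
      by (auto simp: word_dist_def)
    show "word_dist D (x i) (x j) \<in> S - {0}" if "i \<noteq> j" for i j
      using xne[OF that] letter[OF xw] D s by (simp add: word_dist_def)
  qed (assumption | rule that)+
  show thesis
  proof (rule that[of "\<lambda>w. \<phi> (e w)"])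
    show "\<phi> (e w) \<in> U" for w
      by (rule \<phi>(1))
    show "d (\<phi> (e u)) (\<phi> (e v)) = word_dist D u v" if "u \<in> words s 0" "v \<in> words s 0" for u v
      using that by (simp add: \<phi>(2) xe)
  qed
qed

text \<open>In an enumeration of \<open>U\<close>, a point is coded by the list of its distances to
  the earlier points. The word length records the index, so it points to the right entry in every
  later word.\<close>

lemma embed_in_words:
  fixes d :: "'u \<Rightarrow> 'u \<Rightarrow> real"
  assumes U: "S_metric_space S U d" "countable U" "infinite U"
    and D: "bij_betw D {..<s} (S - {0})"
  obtains \<psi> where "\<And>x. x \<in> U \<Longrightarrow> \<psi> x \<in> words s 0"
    "\<And>x y. x \<in> U \<Longrightarrow> y \<in> U \<Longrightarrow> word_dist D (\<psi> x) (\<psi> y) = d x y"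
proof -
  interpret Metric_space U d
    using U by (simp add: S_metric_space_def)
  have dS: "d x y \<in> S" if "x \<in> U" "y \<in> U" for x y
    using U(1) that by (simp add: S_metric_space_def)
  obtain e :: "'u \<Rightarrow> nat" where e: "bij_betw e U UNIV"
    using countableE_infinite[OF U(2,3)] by blast
  define z where "z = inv_into U e"
  have zU: "z i \<in> U" for i
    using bij_betw_inv_into[OF e] by (auto simp: bij_betw_def z_def)
  have ze: "z (e x) = x" if "x \<in> U" for x
    unfolding z_def by (rule bij_betw_inv_into_left[OF e that])
  have ez: "e (z i) = i" for i
    unfolding z_def using bij_betw_inv_into_right[OF e] by simp
  define code where "code = inv_into {..<s} D"
  have code: "code r < s" "D (code r) = r" if "r \<in> S - {0}" for r
    using that D inv_into_into[of r D "{..<s}"] f_inv_into_f[of r D "{..<s}"]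
    by (auto simp: code_def bij_betw_def)
  define \<psi> where "\<psi> x = [0..<s] @ map (\<lambda>j. code (d x (z j))) [0..<e x]" for x
  have dist: "d x (z j) \<in> S - {0}" if "x \<in> U" "j < e x" for x j
  proof -
    have "x \<noteq> z j"
      using that ez[of j] by auto
    then show ?thesis
      using dS[OF that(1) zU] zero[OF that(1) zU] by simp
  qed
  have len: "length (\<psi> x) = s + e x" for x
    by (simp add: \<psi>_def)
  have nth: "D (\<psi> y ! length (\<psi> x)) = d y x" if "x \<in> U" "y \<in> U" "e x < e y" for x y
    using that code(2)[OF dist[OF that(2,3)]] unfolding len by (simp add: \<psi>_def nth_append ze)
  show thesis
  proof (rule that[of \<psi>])
    show "\<psi> x \<in> words s 0" if "x \<in> U" for x
    proof -
      have "map (\<lambda>j. code (d x (z j))) [0..<e x] \<in> lists {..<s}"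
        using code(1)[OF dist[OF that]] by auto
      then show ?thesis
        unfolding words_0_iff \<psi>_def by blast
    qed
    fix x y assume xy: "x \<in> U" "y \<in> U"
    show "word_dist D (\<psi> x) (\<psi> y) = d x y"
    proof (cases "x = y")
      case True
      then show ?thesis
        using xy by (simp add: word_dist_def)
    next
      case False
      then have "e x \<noteq> e y"
        using xy ze by metis
      then have "\<psi> x \<noteq> \<psi> y"
        using len by (metis add_left_cancel)
      then show ?thesis
        using nth[OF xy] nth[OF xy(2,1)] \<open>e x \<noteq> e y\<close> commute[of x y]
        unfolding word_dist_def len by auto
    qed
  qed
qed

theorem theorem5p5:
  fixes S B1 :: "real set"
    and U :: "'u set" and d :: "'u \<Rightarrow> 'u \<Rightarrow> real"
    and A :: "'a set" and dA :: "'a \<Rightarrow> 'a \<Rightarrow> real"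
  assumes "compact_distance_set S"
    and "nontrivial_blocks S = {B1}"
    and "S = {0} \<union> B1"
    and "is_Fraisse_limit S U d"
    and "finite A"
    and "S_metric_space S A dA"
  shows "finite_big_Ramsey_degree A dA U d"
proof (cases "A = {}")
  case True
  \<comment> \<open>For empty \<open>A\<close> there is at most one embedding, so the identity
    serves with \<open>t = 1\<close>.\<close>
  have "(\<lambda>x\<in>U. x) \<in> isometric_embeddings U d U d"
    by (simp add: isometric_embeddings_def)
  moreover have "card ((\<lambda>f. c (compose A w f)) ` isometric_embeddings A dA U d) \<le> 1"
    for c :: "('a \<Rightarrow> 'u) \<Rightarrow> nat" and w
  proof -
    have "isometric_embeddings A dA U d \<subseteq> {\<lambda>_. undefined}"
      using True by (auto simp: isometric_embeddings_def)
    then have "card ((\<lambda>f. c (compose A w f)) ` isometric_embeddings A dA U d)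
        \<le> card ((\<lambda>f. c (compose A w f)) ` {\<lambda>_. undefined})"
      by (intro card_mono image_mono) auto
    then show ?thesis
      by simp
  qed
  ultimately show ?thesis
    unfolding finite_big_Ramsey_degree_def by (intro exI[of _ 1]) blast
next
  case False
  have fin: "finite S" and ne: "S - {0} \<noteq> {}" and pos: "\<And>x. x \<in> S - {0} \<Longrightarrow> 0 < x"
    and tri: "\<And>x y z. x \<in> S - {0} \<Longrightarrow> y \<in> S - {0} \<Longrightarrow> z \<in> S - {0} \<Longrightarrow> x \<le> y + z"
    using one_block_distances[OF assms(1-3)] by blast+
  have S0: "0 \<in> S"
    using assms(3) by blast
  have U: "S_metric_space S U d" "countable U" "infinite U"
    using assms(4) by (simp_all add: is_Fraisse_limit_def)
  define s where "s = card (S - {0})"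
  have s: "0 < s"
    using fin ne by (simp add: s_def card_gt_0_iff)
  obtain D where D: "bij_betw D {..<s} (S - {0})"
    using ex_bij_betw_nat_finite[of "S - {0}"] fin by (auto simp: s_def atLeast0LessThan)
  then have DS: "D i \<in> S - {0}" if "i < s" for i
    using that by (auto dest: bij_betwE)
  obtain \<phi> where \<phi>: "\<And>w. \<phi> w \<in> U"
    "\<And>u v. u \<in> words s 0 \<Longrightarrow> v \<in> words s 0 \<Longrightarrow> d (\<phi> u) (\<phi> v) = word_dist D u v"
    by (rule words_embed[OF tri S0 pos assms(4) s DS]) (assumption | rule that)+
  obtain \<psi> where \<psi>: "\<And>x. x \<in> U \<Longrightarrow> \<psi> x \<in> words s 0"
    "\<And>x y. x \<in> U \<Longrightarrow> y \<in> U \<Longrightarrow> word_dist D (\<psi> x) (\<psi> y) = d x y"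
    by (rule embed_in_words[OF U D]) (rule that)
  obtain t where t: "t > 0"
    "\<And>c :: ('a \<Rightarrow> nat list) \<Rightarrow> nat. finite (range c) \<Longrightarrow>
       \<exists>W. rigid s W \<and> card ((\<lambda>f. c (\<lambda>a\<in>A. act (f a) W)) ` (A \<rightarrow>\<^sub>E words s 0)) \<le> t"
    by (rule finite_big_Ramsey_degree_tuples[OF assms(5) False s]) (rule that)
  show ?thesis
    unfolding finite_big_Ramsey_degree_def
  proof (intro exI[of _ t] conjI allI impI ballI)
    show "t > 0"
      by (rule t(1))
    fix k :: nat and c
    assume "c \<in> isometric_embeddings A dA U d \<rightarrow> {..<k}"
    then have c: "\<And>f. f \<in> isometric_embeddings A dA U d \<Longrightarrow> c f < k"
      by blast
    \<comment> \<open>\<open>c\<close> is pulled back along \<phi> to arbitrary tuples of words;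
      those that do not give embeddings of \<open>A\<close> get the colour \<open>0\<close>.\<close>
    define c' where "c' f = (if compose A \<phi> f \<in> isometric_embeddings A dA U d
        then c (compose A \<phi> f) else 0)" for f
    have "range c' \<subseteq> insert 0 {..<k}"
      using c by (auto simp: c'_def)
    then have fc: "finite (range c')"
      by (rule finite_subset) simp
    obtain W where W: "rigid s W"
      and card: "card ((\<lambda>f. c' (\<lambda>a\<in>A. act (f a) W)) ` (A \<rightarrow>\<^sub>E words s 0)) \<le> t"
      using t(2)[OF fc] by blast
    \<comment> \<open>The self-embedding passes through words: code by \<psi>, substitute into
      \<open>W\<close>, return by \<phi>.\<close>
    define w where "w = (\<lambda>x\<in>U. \<phi> (act (\<psi> x) W))"
    have w: "w \<in> isometric_embeddings U d U d"
      unfolding isometric_embeddings_def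
    proof (intro CollectI conjI ballI)
      show "w \<in> U \<rightarrow>\<^sub>E U"
        using \<phi>(1) by (simp add: w_def)
      show "d (w x) (w y) = d x y" if "x \<in> U" "y \<in> U" for x y
        using that by (simp add: w_def \<phi>(2) \<psi> act_words[OF W] word_dist_act[OF W])
    qed
    have "(\<lambda>f. c (compose A w f)) ` isometric_embeddings A dA U d
        \<subseteq> (\<lambda>f. c' (\<lambda>a\<in>A. act (f a) W)) ` (A \<rightarrow>\<^sub>E words s 0)"
    proof (rule image_subsetI)
      fix f assume f: "f \<in> isometric_embeddings A dA U d"
      then have fU: "f a \<in> U" if "a \<in> A" for a
        using that by (auto simp: isometric_embeddings_def)
      define f' where "f' = (\<lambda>a\<in>A. \<psi> (f a))"
      have f': "f' \<in> A \<rightarrow>\<^sub>E words s 0"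
        using fU \<psi>(1) by (simp add: f'_def)
      have "compose A w f \<in> isometric_embeddings A dA U d"
        using f w fU by (auto simp: isometric_embeddings_def compose_def)
      \<comment> \<open>So each colour met by \<open>w\<close> is a \<open>c'\<close>-colour of a
        tuple substituted into \<open>W\<close>, and those are at most \<open>t\<close> in
        number.\<close>
      moreover have "compose A w f = compose A \<phi> (\<lambda>a\<in>A. act (f' a) W)"
        unfolding compose_def by (rule restrict_ext) (simp add: w_def f'_def fU)
      ultimately have "c (compose A w f) = c' (\<lambda>a\<in>A. act (f' a) W)"
        by (simp add: c'_def)
      then show "c (compose A w f) \<in> (\<lambda>f. c' (\<lambda>a\<in>A. act (f a) W)) ` (A \<rightarrow>\<^sub>E words s 0)"
        using f' by blast
    qed
    moreover have "finite ((\<lambda>f. c' (\<lambda>a\<in>A. act (f a) W)) ` (A \<rightarrow>\<^sub>E words s 0))"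
      by (rule finite_subset[OF _ fc]) blast
    ultimately have "card ((\<lambda>f. c (compose A w f)) ` isometric_embeddings A dA U d) \<le> t"
      using card card_mono le_trans by blast
    with w show "\<exists>w\<in>isometric_embeddings U d U d.
        card ((\<lambda>f. c (compose A w f)) ` isometric_embeddings A dA U d) \<le> t"
      by blast
  qed
qed

end
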